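(* Let $\varepsilon>0$, assume that $\lambda>\lambda_0=3/2^{2/3}$, and assume that there is an $\bar\alpha\in(\alpha_0,-\sqrt{\lambda/3})$ such that $u_{\bar\alpha}(t)$ increases monotonically as $t$ increases from $0$ and crosses $u=b$ before $t=\pi/2$. Let $\{w_k\}$ be the associated family of spike solutions. Let $\Omega=\{\omega_k\}_{k\ge1}$ be a sequence chosen from the integers $\{1,2,3,4,5\}$. Assume that no $1$ or $2$ is followed immediately by a $4$ or $5$, and no $4$ or $5$ is followed immediately by a $1$ or $2$. Then there is a solution $u=u_\Omega$ of $\varepsilon^2u''=u^3-\lambda u+\cos t$ with the following properties: (i) If $\omega_k=1$ or $2$, then $u$ intersects $w_{2k-1}$ at two points and does not intersect $w_{2k}$. (ii) If $\omega_k=1$, then $u<g_-$ in $((2k-2)\pi,2k\pi)$, while if $\omega_k=2$, then $u>g_-$ somewhere in this interval. (iii) If $\omega_k=3$, then $u$ does not intersect either $w_{2k-1}$ or $w_{2k}$. (iv) If $\omega_k=4$ or $5$, then $u$ does not intersect $w_{2k-1}$ but does intersect $w_{2k}$, at two points. (v) If $\omega_k=4$, then $u$ falls below $g_+$ in $((2k-1)\pi,(2k+1)\pi)$, while if $\omega_k=5$, then $u>g_+$ in this interval.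
   Context: For $\alpha\in\mathbb{R}$, $u_\alpha$ denotes the solution of $\varepsilon^2u''=u^3-\lambda u+\cos t$ with $u(0)=\alpha$, $u'(0)=0$. The number $b>0$ is fixed with $b^3-\lambda b-1>0$. $\alpha_0$ is the smallest real root of $u^3-\lambda u+1=0$. Given $\bar\alpha$ as in the hypothesis, define $\hat w_k(t)=(-1)^k u_{\bar\alpha}(t-k\pi)$, and let $w_k$ be the restriction of $\hat w_k$ to the interval $[s_k,S_k]$ (containing $k\pi$, of half-length less than $\pi/2$) in which $|\hat w_k|\le b$. "$u$ intersects $w_k$" means that the graphs intersect. Define $$f_+(t)=\begin{cases} w_k(t) & \text{if } k \text{ is even and } s_k\le t\le S_k,\\ b&\text{otherwise,}\end{cases}\qquad f_-(t)=\begin{cases} w_k(t) & \text{if } k \text{ is odd and } s_k\le t\le S_k,\\ -b&\text{otherwise,}\end{cases}$$ $$g_+(t)=\max\{\sqrt{\lambda/3},\,f_-(t)\},\qquad g_-(t)=\min\{-\sqrt{\lambda/3},\,f_+(t)\}.$$ *)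

theory Defs
  imports "HOL-Analysis.Analysis"
begin

definition solves_on :: "real \<Rightarrow> real \<Rightarrow> (real \<Rightarrow> real) \<Rightarrow> real set \<Rightarrow> bool" where
  "solves_on \<epsilon> lam u J \<longleftrightarrow>
     (\<forall>t\<in>J. u differentiable (at t) \<and> deriv u differentiable (at t) \<and>
        \<epsilon>\<^sup>2 * deriv (deriv u) t = u t ^ 3 - lam * u t + cos t)"

definition ivp_solution :: "real \<Rightarrow> real \<Rightarrow> real \<Rightarrow> (real \<Rightarrow> real) \<Rightarrow> real set \<Rightarrow> bool" where
  "ivp_solution \<epsilon> lam \<alpha> u J \<longleftrightarrow>
     open J \<and> is_interval J \<and> 0 \<in> J \<and> solves_on \<epsilon> lam u J \<and> u 0 = \<alpha> \<and> deriv u 0 = 0"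

text \<open>Solutions may blow up in finite time, so the solution with \<open>u 0 = \<alpha>\<close>, \<open>u' 0 = 0\<close> is
  considered on its maximal interval of existence \<open>max_interval\<close>. Any two local solutions agree
  where both are defined, which makes the value \<open>u_sol\<close> unique there; outside the maximal
  interval \<open>u_sol\<close> is unspecified.\<close>

definition max_interval :: "real \<Rightarrow> real \<Rightarrow> real \<Rightarrow> real set" where
  "max_interval \<epsilon> lam \<alpha> = \<Union>{J. \<exists>u. ivp_solution \<epsilon> lam \<alpha> u J}"

definition u_sol :: "real \<Rightarrow> real \<Rightarrow> real \<Rightarrow> real \<Rightarrow> real" where
  "u_sol \<epsilon> lam \<alpha> t = (THE x. \<exists>u J. ivp_solution \<epsilon> lam \<alpha> u J \<and> t \<in> J \<and> u t = x)"

definition alpha0 :: "real \<Rightarrow> real" where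
  "alpha0 lam = (LEAST x. x ^ 3 - lam * x + 1 = 0)"

text \<open>The spike \<open>w\<^sub>k\<close> is the partial function given by \<open>spike \<epsilon> lam \<alpha> k\<close> on the
  interval \<open>spike_dom \<epsilon> lam b \<alpha> k\<close>, which is \<open>[s\<^sub>k, S\<^sub>k]\<close>.\<close>

definition spike :: "real \<Rightarrow> real \<Rightarrow> real \<Rightarrow> int \<Rightarrow> real \<Rightarrow> real" where
  "spike \<epsilon> lam \<alpha> k t = (-1) powi k * u_sol \<epsilon> lam \<alpha> (t - of_int k * pi)"

definition spike_dom :: "real \<Rightarrow> real \<Rightarrow> real \<Rightarrow> real \<Rightarrow> int \<Rightarrow> real set" where
  "spike_dom \<epsilon> lam b \<alpha> k =
     connected_component_set
       {t. t - of_int k * pi \<in> max_interval \<epsilon> lam \<alpha> \<and> \<bar>spike \<epsilon> lam \<alpha> k t\<bar> \<le> b}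
       (of_int k * pi)"

definition spike_meets ::
    "real \<Rightarrow> real \<Rightarrow> real \<Rightarrow> real \<Rightarrow> (real \<Rightarrow> real) \<Rightarrow> int \<Rightarrow> real set" where
  "spike_meets \<epsilon> lam b \<alpha> u k = {t \<in> spike_dom \<epsilon> lam b \<alpha> k. u t = spike \<epsilon> lam \<alpha> k t}"

text \<open>In the situation of interest the intervals \<open>spike_dom\<close> have half-length less than
  \<open>pi / 2\<close>, hence are pairwise disjoint and the index \<open>k\<close> below is unique.\<close>

definition f_plus :: "real \<Rightarrow> real \<Rightarrow> real \<Rightarrow> real \<Rightarrow> real \<Rightarrow> real" where
  "f_plus \<epsilon> lam b \<alpha> t =
     (if \<exists>k. even k \<and> t \<in> spike_dom \<epsilon> lam b \<alpha> k
      then spike \<epsilon> lam \<alpha> (THE k. even k \<and> t \<in> spike_dom \<epsilon> lam b \<alpha> k) t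
      else b)"

definition f_minus :: "real \<Rightarrow> real \<Rightarrow> real \<Rightarrow> real \<Rightarrow> real \<Rightarrow> real" where
  "f_minus \<epsilon> lam b \<alpha> t =
     (if \<exists>k. odd k \<and> t \<in> spike_dom \<epsilon> lam b \<alpha> k
      then spike \<epsilon> lam \<alpha> (THE k. odd k \<and> t \<in> spike_dom \<epsilon> lam b \<alpha> k) t
      else - b)"

definition g_plus :: "real \<Rightarrow> real \<Rightarrow> real \<Rightarrow> real \<Rightarrow> real \<Rightarrow> real" where
  "g_plus \<epsilon> lam b \<alpha> t = max (sqrt (lam / 3)) (f_minus \<epsilon> lam b \<alpha> t)"

definition g_minus :: "real \<Rightarrow> real \<Rightarrow> real \<Rightarrow> real \<Rightarrow> real \<Rightarrow> real" where
  "g_minus \<epsilon> lam b \<alpha> t = min (- sqrt (lam / 3)) (f_plus \<epsilon> lam b \<alpha> t)"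

end

theory Submission
  imports Defs
begin

text \<open>
  Replace \<open>u\<close> by its truncation to \<open>[- b, b]\<close> in the cubic. Solutions then exist globally and
  depend continuously on the initial value, and since \<open>\<plusminus>b\<close> are strict barriers, a solution that has
  left \<open>[- b, b]\<close> never returns; a solution that stays inside solves the original equation.

  The key fact is one-sided: a solution crossing the right half of \<open>w\<^sub>0\<close> upwards runs above \<open>w\<^sub>0\<close>
  until it leaves through \<open>b\<close>, because it reaches each height earlier than \<open>w\<^sub>0\<close> and \<open>cos\<close> decreases on
  \<open>[0, \<pi>]\<close>. By the symmetries \<open>t \<mapsto> - t\<close> and \<open>(u, t) \<mapsto> (- u, t + \<pi>)\<close>, a solution staying inside meets
  each \<open>w\<^sub>n\<close> twice or not at all, depending only on its position at \<open>n\<pi>\<close>.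

  The symbols are realized by shooting in \<open>u 0\<close>. Suppose that along a parameter interval the solution,
  turned so that \<open>w\<^sub>n\<close> becomes \<open>w\<^sub>0\<close>, sweeps from \<open>- b\<close> to the minimum of \<open>w\<^sub>0\<close> at time \<open>n\<pi>\<close>. The
  intermediate value theorem yields subintervals that sweep likewise at \<open>(n + 1)\<pi>\<close>, or at \<open>(n + 2)\<pi>\<close>
  after staying below \<open>- sqrt (lam / 3)\<close>, or at \<open>(n + 2)\<pi>\<close> after a spike above that level which still
  passes below the peak of \<open>w\<^sub>n\<^sub>+\<^sub>1\<close>. Every admissible sequence is a concatenation of these moves.
\<close>

section \<open>Linear growth estimates and global solutions\<close>

text \<open>Gronwall's inequality for v^2 + dv^2: the derivative is at most \<open>1 + K\<close>
  times the quantity itself, by 2xy \<le> x^2 + y^2. Applied to differences of solutions it yields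
  uniqueness and continuous dependence.\<close>

lemma DERIV_energy_growth:
  fixes v dv ddv :: "real \<Rightarrow> real"
  assumes "\<And>t. t \<in> {a..c} \<Longrightarrow> (v has_real_derivative dv t) (at t)"
    and "\<And>t. t \<in> {a..c} \<Longrightarrow> (dv has_real_derivative ddv t) (at t)"
    and K: "\<And>t. t \<in> {a..c} \<Longrightarrow> \<bar>ddv t\<bar> \<le> K * \<bar>v t\<bar>"
    and "a \<le> c" "K \<ge> 0"
  shows "(v c)\<^sup>2 + (dv c)\<^sup>2 \<le> ((v a)\<^sup>2 + (dv a)\<^sup>2) * exp ((1 + K) * (c - a))"
proof -
  define E where "E t = ((v t)\<^sup>2 + (dv t)\<^sup>2) * exp (- (1 + K) * t)" for t
  have "E c \<le> E a"
  proof (rule DERIV_nonpos_imp_nonincreasing[OF \<open>a \<le> c\<close>])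
    fix t assume t: "a \<le> t" "t \<le> c"
    have "\<bar>2 * (dv t * ddv t)\<bar> \<le> 2 * (\<bar>dv t\<bar> * (K * \<bar>v t\<bar>))"
      using K[of t] t by (simp add: abs_mult mult_left_mono)
    also have "\<dots> = K * (2 * \<bar>v t\<bar> * \<bar>dv t\<bar>)" by simp
    also have "\<dots> \<le> K * ((v t)\<^sup>2 + (dv t)\<^sup>2)"
      using sum_squares_bound[of "\<bar>v t\<bar>" "\<bar>dv t\<bar>"] \<open>K \<ge> 0\<close> by (intro mult_left_mono) auto
    finally have 1: "2 * (dv t * ddv t) \<le> K * ((v t)\<^sup>2 + (dv t)\<^sup>2)" by simp
    have 2: "2 * (v t * dv t) \<le> (v t)\<^sup>2 + (dv t)\<^sup>2"
      using sum_squares_bound[of "v t" "dv t"] by simp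
    have "(E has_real_derivative
        (2 * (v t * dv t) + 2 * (dv t * ddv t) - (1 + K) * ((v t)\<^sup>2 + (dv t)\<^sup>2)) * exp (- (1 + K) * t)) (at t)"
      unfolding E_def
      by (rule derivative_eq_intros assms refl | use t in force)+ (simp add: algebra_simps)
    moreover have "2 * (v t * dv t) + 2 * (dv t * ddv t) - (1 + K) * ((v t)\<^sup>2 + (dv t)\<^sup>2) \<le> 0"
      using 1 2 by (simp add: algebra_simps)
    ultimately show "\<exists>y. (E has_real_derivative y) (at t) \<and> y \<le> 0"
      by (meson exp_ge_zero mult_nonpos_nonneg)
  qed
  hence "E c * exp ((1 + K) * c) \<le> E a * exp ((1 + K) * c)"
    by (rule mult_right_mono) simp
  thus ?thesis
    by (simp add: E_def mult.assoc flip: exp_add) (simp add: algebra_simps)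
qed

lemma antiderivative_exists:
  fixes h :: "real \<Rightarrow> real"
  assumes "continuous_on UNIV h"
  obtains H where "\<And>t. (H has_real_derivative h t) (at t)" "H 0 = 0"
proof -
  define H where "H t = (LBINT y=ereal 0..ereal t. h y)" for t :: real
  have "(H has_real_derivative h t) (at t)" for t
  proof -
  \<comment> \<open>The interval contains \<open>0\<close> and has \<open>t\<close> in its interior,
    so the derivative within it is the full derivative.\<close>
  have "((\<lambda>u. LBINT y=ereal 0..ereal u. h y) has_vector_derivative h t) (at t within {- \<bar>t\<bar> - 1..\<bar>t\<bar> + 1})"
    by (rule interval_integral_FTC2) (auto intro: continuous_on_subset[OF assms])
  moreover have "at t within {- \<bar>t\<bar> - 1..\<bar>t\<bar> + 1} = at t"
    by (rule at_within_interior) auto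
  ultimately show ?thesis
    by (simp add: H_def[abs_def] has_real_derivative_iff_has_vector_derivative)
  qed
  moreover have "H 0 = 0" by (simp add: H_def zero_ereal_def)
  ultimately show ?thesis using that by blast
qed

text \<open>Integration gains a factor \<open>1 / K\<close> in the norm weighted by
  \<open>exp (- K * \<bar>t\<bar>)\<close>. This makes the Picard map a contraction on the whole
  line.\<close>

lemma antiderivative_exp_bound:
  fixes H :: "real \<Rightarrow> real"
  assumes H: "\<And>t. (H has_real_derivative h t) (at t)" "H 0 = 0"
    and h: "\<And>t. \<bar>h t\<bar> \<le> M * exp (K * \<bar>t\<bar>)" and "K > 0"
  shows "\<bar>H t\<bar> \<le> M / K * exp (K * \<bar>t\<bar>)"
proof -
  have M: "M \<ge> 0" using h[of 0] by simp
  have *: "G t \<le> M / K * exp (K * t)"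
    if G: "\<And>t. (G has_real_derivative g t) (at t)" "G 0 = 0"
      and g: "\<And>t. g t \<le> M * exp (K * \<bar>t\<bar>)" and t: "t \<ge> 0" for G g t
  proof -
    have "G t - M / K * exp (K * t) \<le> G 0 - M / K * exp (K * 0)"
    proof (rule DERIV_nonpos_imp_nonincreasing[OF t])
      fix s :: real assume s: "0 \<le> s" "s \<le> t"
      have "((\<lambda>t. G t - M / K * exp (K * t)) has_real_derivative g s - M * exp (K * s)) (at s)"
        using \<open>K > 0\<close> by (auto intro!: derivative_eq_intros G)
      thus "\<exists>y. ((\<lambda>t. G t - M / K * exp (K * t)) has_real_derivative y) (at s) \<and> y \<le> 0"
        using g[of s] s by (intro exI[of _ "g s - M * exp (K * s)"]) auto
    qed
    moreover have "M / K \<ge> 0" using M \<open>K > 0\<close> by simp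
    ultimately show ?thesis using G(2) by simp
  qed
  \<comment> \<open>The bound \<open>*\<close> covers positive times and one sign only; reflections
    and sign changes of \<open>H\<close> give the rest.\<close>
  have D: "((\<lambda>t. H (- t)) has_real_derivative - h (- t)) (at t)"
    "((\<lambda>t. - H t) has_real_derivative - h t) (at t)"
    "((\<lambda>t. - H (- t)) has_real_derivative h (- t)) (at t)" for t
    using DERIV_mirror[of H "h (- t)" t] H(1)[of "- t"] H(1)[of t]
    by (auto intro!: derivative_eq_intros)
  have hb: "h t \<le> M * exp (K * \<bar>t\<bar>)" "- h t \<le> M * exp (K * \<bar>t\<bar>)"
     "h (- t) \<le> M * exp (K * \<bar>t\<bar>)" "- h (- t) \<le> M * exp (K * \<bar>t\<bar>)" for t
    using h[of t] h[of "- t"] by auto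
  show ?thesis
  proof (cases "t \<ge> 0")
    case True
    thus ?thesis using *[OF H hb(1) True] *[OF D(2) _ hb(2) True] H(2) by simp
  next
    case False
    hence "- t \<ge> 0" by simp
    thus ?thesis using *[OF D(1) _ hb(4), of "- t"] *[OF D(3) _ hb(3), of "- t"] H(2) False by simp
  qed
qed

text \<open>Picard iteration in an exponentially weighted supremum norm: one contraction works on
  the whole line, so no local solutions have to be glued.\<close>

lemma second_order_ivp_global:
  fixes F :: "real \<Rightarrow> real \<Rightarrow> real"
  assumes cont: "continuous_on UNIV (\<lambda>(x, t). F x t)"
    and bd: "\<And>x t. \<bar>F x t\<bar> \<le> M"
    and lip: "\<And>x y t. \<bar>F x t - F y t\<bar> \<le> L * \<bar>x - y\<bar>"
  obtains u du where "\<And>t. (u has_real_derivative du t) (at t)"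
    "\<And>t. (du has_real_derivative F (u t) t) (at t)" "u 0 = a" "du 0 = 0"
proof -
  have "L \<ge> 0" using lip[of 1 0 0] by simp
  have "M \<ge> 0" using bd[of 0 0] by simp
  \<comment> \<open>Two integrations contract by \<open>L / K\<^sup>2\<close>, and this choice makes
    that at most \<open>1/2\<close>.\<close>
  define K where "K = 1 + 2 * L"
  have K: "K > 0" "K \<ge> 1" using \<open>L \<ge> 0\<close> by (auto simp: K_def)
  have K2: "L / K\<^sup>2 \<le> 1/2"
  proof -
    have "2 * L \<le> K" by (simp add: K_def)
    also have "\<dots> \<le> K\<^sup>2" using K by (simp add: power2_eq_square)
    finally show ?thesis using K by (simp add: field_simps)
  qed
  define P where "P h = (SOME H. (\<forall>t. (H has_real_derivative h t) (at t)) \<and> H 0 = 0)"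
    for h :: "real \<Rightarrow> real"
  have P: "(P h has_real_derivative h t) (at t)" "P h 0 = 0" if "continuous_on UNIV h" for h t
    using someI_ex[of "\<lambda>H. (\<forall>t. (H has_real_derivative h t) (at t)) \<and> H 0 = 0"]
      antiderivative_exists[OF that] unfolding P_def by blast+
  have Pc: "continuous_on UNIV (P h)" if "continuous_on UNIV h" for h
    using P(1)[OF that] by (meson DERIV_continuous continuous_at_imp_continuous_on)
  \<comment> \<open>The iterate is stored divided by its weight, hence as a bounded continuous
    function; \<open>Y\<close> restores the weight, and \<open>R\<close> below is the Picard map in
    this form.\<close>
  define Y where "Y z = (\<lambda>t. exp (K * \<bar>t\<bar>) * apply_bcontfun z t)" for z :: "real \<Rightarrow>\<^sub>C real"
  define N where "N z = (\<lambda>t. F (Y z t) t)" for z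
  have Nc: "continuous_on UNIV (N z)" for z
  proof -
    have "continuous_on UNIV (\<lambda>t. (\<lambda>(x, t). F x t) (Y z t, t))"
      unfolding Y_def
      by (rule continuous_on_compose2[OF cont])
        (auto intro!: continuous_intros continuous_on_apply_bcontfun)
    thus ?thesis by (simp add: N_def)
  qed
  define Q where "Q z = P (P (N z))" for z
  note Q = P[OF Pc[OF Nc], folded Q_def] P[OF Nc]
  define R where "R z = (\<lambda>t. exp (- K * \<bar>t\<bar>) * (a + Q z t))" for z
  have ge1: "exp (K * \<bar>t\<bar>) \<ge> 1" for t using K by simp
  have "\<bar>N z t\<bar> \<le> M * exp (K * \<bar>t\<bar>)" for z t
    using bd[of "Y z t" t] mult_left_mono[OF ge1[of t] \<open>M \<ge> 0\<close>] by (simp add: N_def)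
  from antiderivative_exp_bound[OF Q(1,2) antiderivative_exp_bound[OF Q(3,4) this K(1)] K(1)]
  have Qb: "\<bar>Q z t\<bar> \<le> M / K / K * exp (K * \<bar>t\<bar>)" for z t .
  have Rb: "R z \<in> bcontfun" for z
  proof (rule bcontfun_normI)
    have "continuous_on UNIV (Q z)"
      using Q(1) by (meson DERIV_continuous continuous_at_imp_continuous_on)
    thus "continuous_on UNIV (R z)" unfolding R_def by (intro continuous_intros)
    fix t
    have "\<bar>a + Q z t\<bar> \<le> (\<bar>a\<bar> + M / K / K) * exp (K * \<bar>t\<bar>)"
      using Qb[of z t] mult_left_mono[OF ge1[of t] abs_ge_zero[of a]] by (simp add: algebra_simps)
    hence "exp (- K * \<bar>t\<bar>) * \<bar>a + Q z t\<bar> \<le> exp (- K * \<bar>t\<bar>) * ((\<bar>a\<bar> + M / K / K) * exp (K * \<bar>t\<bar>))"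
      by (rule mult_left_mono) simp
    thus "norm (R z t) \<le> \<bar>a\<bar> + M / K / K"
      by (simp add: R_def abs_mult exp_minus field_simps)
  qed
  have "dist (Bcontfun (R z)) (Bcontfun (R y)) \<le> 1/2 * dist z y" for z y
  proof (rule dist_bound)
    fix t
    have "\<bar>N z s - N y s\<bar> \<le> (L * dist z y) * exp (K * \<bar>s\<bar>)" for s
    proof -
      have "\<bar>N z s - N y s\<bar> \<le> L * \<bar>Y z s - Y y s\<bar>" unfolding N_def by (rule lip)
      also have "\<bar>Y z s - Y y s\<bar> = exp (K * \<bar>s\<bar>) * dist (apply_bcontfun z s) (apply_bcontfun y s)"
        by (simp add: Y_def dist_real_def abs_mult flip: right_diff_distrib)
      also have "L * \<dots> \<le> L * (exp (K * \<bar>s\<bar>) * dist z y)"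
        using \<open>L \<ge> 0\<close> by (intro mult_left_mono dist_bounded) auto
      finally show ?thesis by (simp add: mult_ac)
    qed
    from antiderivative_exp_bound[OF DERIV_diff[OF Q(3) Q(3)] _ this K(1)]
    have "\<bar>P (N z) s - P (N y) s\<bar> \<le> L * dist z y / K * exp (K * \<bar>s\<bar>)" for s
      using Q(4) by simp
    from antiderivative_exp_bound[OF DERIV_diff[OF Q(1) Q(1)] _ this K(1)]
    have "\<bar>Q z t - Q y t\<bar> \<le> L * dist z y / K / K * exp (K * \<bar>t\<bar>)"
      using Q(2) by simp
    hence "exp (- K * \<bar>t\<bar>) * \<bar>Q z t - Q y t\<bar> \<le> exp (- K * \<bar>t\<bar>) * (L * dist z y / K / K * exp (K * \<bar>t\<bar>))"
      by (rule mult_left_mono) simp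
    also have "\<dots> = L / K\<^sup>2 * dist z y" by (simp add: exp_minus field_simps power2_eq_square)
    also have "\<dots> \<le> 1/2 * dist z y" using K2 by (intro mult_right_mono) auto
    finally show "dist (apply_bcontfun (Bcontfun (R z)) t) (apply_bcontfun (Bcontfun (R y)) t) \<le> 1/2 * dist z y"
      by (simp add: Bcontfun_inverse Rb) (simp add: R_def dist_real_def abs_mult flip: right_diff_distrib)
  qed
  then obtain z where z: "Bcontfun (R z) = z"
    using banach_fix_type[of "1/2" "\<lambda>z. Bcontfun (R z)"] by auto
  have "apply_bcontfun z t = R z t" for t
    by (subst z[symmetric]) (simp add: Bcontfun_inverse Rb)
  hence Y: "Y z t = a + Q z t" for t
    by (simp add: Y_def R_def exp_minus)
  show ?thesis
  proof
    show "((\<lambda>t. a + Q z t) has_real_derivative P (N z) t) (at t)" for t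
      by (auto intro!: derivative_eq_intros Q)
    show "(P (N z) has_real_derivative F (a + Q z t) t) (at t)" for t
      using Q(3)[of z t] by (simp add: N_def Y)
  qed (simp_all add: Q)
qed

lemma cubic_lipschitz:
  fixes x y C l :: real
  assumes "\<bar>x\<bar> \<le> C" "\<bar>y\<bar> \<le> C" "l \<ge> 0"
  shows "\<bar>(x ^ 3 - l * x) - (y ^ 3 - l * y)\<bar> \<le> (3 * C\<^sup>2 + l) * \<bar>x - y\<bar>"
proof -
  have C: "C \<ge> 0" using assms(1) by linarith
  have "\<bar>x * x\<bar> \<le> C\<^sup>2" "\<bar>x * y\<bar> \<le> C\<^sup>2" "\<bar>y * y\<bar> \<le> C\<^sup>2"
    using assms(1,2) C by (simp_all add: abs_mult power2_eq_square mult_mono del: abs_mult_self_eq)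
  hence "\<bar>x * x + x * y + y * y - l\<bar> \<le> 3 * C\<^sup>2 + l" using \<open>l \<ge> 0\<close> by linarith
  hence "\<bar>x * x + x * y + y * y - l\<bar> * \<bar>x - y\<bar> \<le> (3 * C\<^sup>2 + l) * \<bar>x - y\<bar>"
    by (rule mult_right_mono) simp
  moreover have "(x ^ 3 - l * x) - (y ^ 3 - l * y) = (x * x + x * y + y * y - l) * (x - y)"
    by (simp add: power3_eq_cube algebra_simps)
  ultimately show ?thesis by (simp add: abs_mult)
qed

section \<open>The truncated equation\<close>

text \<open>By the mean value theorem it is enough that \<open>du\<close> is positive just after
  \<open>t\<close>, which \<open>D > 0\<close> ensures even if \<open>du t = 0\<close>.\<close>

lemma DERIV_second_increasing_right:
  fixes u du :: "real \<Rightarrow> real"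
  assumes u: "\<And>s. (u has_real_derivative du s) (at s)"
    and du: "(du has_real_derivative D) (at t)"
    and "du t \<ge> 0" "D > 0"
  obtains \<delta> where "\<delta> > 0" "\<And>s. t < s \<Longrightarrow> s < t + \<delta> \<Longrightarrow> u t < u s"
proof -
  obtain d where d: "d > 0" "\<And>h. h > 0 \<Longrightarrow> h < d \<Longrightarrow> du t < du (t + h)"
    using DERIV_pos_inc_right[OF du \<open>D > 0\<close>] by blast
  have "u t < u s" if s: "t < s" "s < t + d" for s
  proof -
    obtain z where z: "t < z" "z < s" "u s - u t = (s - t) * du z"
      using MVT2[OF s(1), of u du] u by blast
    have "du z > 0" using d(2)[of "z - t"] z s \<open>du t \<ge> 0\<close> by simp
    hence "(s - t) * du z > 0" using s by simp
    thus ?thesis using z(3) by simp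
  qed
  thus ?thesis using d(1) that by blast
qed

lemma interior_max_second_derivative:
  fixes u du :: "real \<Rightarrow> real"
  assumes u: "\<And>s. (u has_real_derivative du s) (at s)"
    and du: "(du has_real_derivative D) (at t)" and "a < t" "t < c"
    and mx: "\<And>s. a \<le> s \<Longrightarrow> s \<le> c \<Longrightarrow> u s \<le> u t"
  shows "D \<le> 0"
proof (rule ccontr)
  assume "\<not> D \<le> 0"
  hence D: "D > 0" by simp
  have "du t = 0"
    by (rule DERIV_local_max[OF u[of t], of "min (t - a) (c - t)"]) (use assms in \<open>auto simp: abs_less_iff\<close>)
  then obtain d where d: "d > 0" "\<And>s. t < s \<Longrightarrow> s < t + d \<Longrightarrow> u t < u s"
    using DERIV_second_increasing_right[OF u du _ D] by auto
  obtain s where "t < s" "s < min (t + d) c"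
    using dense[of t "min (t + d) c"] d(1) \<open>t < c\<close> by auto
  thus False using d(2)[of s] mx[of s] \<open>a < t\<close> by force
qed

text \<open>The point is the least element of the compact set where \<open>d\<close> is nonnegative;
  it serves the first-contact arguments below.\<close>

lemma first_nonneg:
  fixes d :: "real \<Rightarrow> real"
  assumes "continuous_on {a..c} d" "a < c" "d a < 0" "d c \<ge> 0"
  obtains t where "a < t" "t \<le> c" "d t = 0" "\<And>s. a \<le> s \<Longrightarrow> s < t \<Longrightarrow> d s < 0"
proof -
  define A where "A = {x \<in> {a..c}. d x \<in> {0..}}"
  have "closed A"
    using continuous_closed_preimage[OF assms(1), of "{0..}"] by (simp add: A_def vimage_def Int_def)
  moreover have "bounded A"
    by (rule bounded_subset[of "{a..c}"]) (auto simp: A_def)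
  ultimately have "compact A" by (simp add: compact_eq_bounded_closed)
  moreover have "c \<in> A" using assms by (auto simp: A_def)
  ultimately obtain t where t: "t \<in> A" "\<And>s. s \<in> A \<Longrightarrow> t \<le> s"
    using compact_attains_inf[of A] by auto
  have tA: "a \<le> t" "t \<le> c" "d t \<ge> 0" using t(1) by (simp_all add: A_def)
  have neg: "d s < 0" if "a \<le> s" "s < t" for s
    using t(2)[of s] that tA(2) by (force simp: A_def)
  have "a \<noteq> t" using tA(3) assms(3) by force
  hence "a < t" using tA(1) by simp
  have "\<exists>x\<ge>a. x \<le> t \<and> d x = 0"
  proof (rule IVT')
    show "continuous_on {a..t} d"
      by (rule continuous_on_subset[OF assms(1)]) (use tA in simp)
  qed (use assms(3) tA in simp_all)
  then obtain x where x: "a \<le> x" "x \<le> t" "d x = 0" by blast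
  have "x = t" using neg[of x] x by force
  thus ?thesis using that[of t] \<open>a < t\<close> tA(2) neg x(3) by simp
qed

section \<open>Truncated nonlinearity and its barriers\<close>

locale truncated_equation =
  fixes e lam b :: real
  assumes e_pos: "e > 0" and lam_gt: "lam > 3 / 2 powr (2 / 3)"
    and b_pos: "b > 0" and b_cubic: "b ^ 3 - lam * b - 1 > 0"
begin

definition clp :: "real \<Rightarrow> real" where "clp x = max (- b) (min b x)"

definition F :: "real \<Rightarrow> real \<Rightarrow> real" where
  "F x t = (clp x ^ 3 - lam * clp x + cos t) / e\<^sup>2"

definition sol :: "(real \<Rightarrow> real) \<Rightarrow> (real \<Rightarrow> real) \<Rightarrow> bool" where
  "sol u du \<longleftrightarrow> (\<forall>t. (u has_real_derivative du t) (at t) \<and> (du has_real_derivative F (u t) t) (at t))"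

abbreviation r where "r \<equiv> sqrt (lam / 3)"

lemma lam_pos: "lam > 0"
proof -
  have "3 / 2 powr (2 / 3) > (0 :: real)" by simp
  thus ?thesis using lam_gt by linarith
qed

lemma r_pos: "r > 0"
  using lam_pos by simp

lemma lam_eq: "lam = 3 * r\<^sup>2"
  using lam_pos by simp

text \<open>The meaning of the threshold for \<open>lam\<close>: \<open>2 * r ^ 3\<close> is the
  local maximum of x^3 - lam x, attained at \<open>- r\<close>, and lam^3 > 27/4 says that it
  exceeds the forcing amplitude 1.\<close>

lemma r_cubed: "2 * r ^ 3 > 1"
proof -
  have p: "(2 powr (2 / 3) :: real) ^ 3 = 4"
    by (simp flip: powr_realpow add: powr_powr)
  have "27 / 4 = (3 / 2 powr (2 / 3) :: real) ^ 3"
    by (simp only: power_divide p) simp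
  also have "\<dots> < lam ^ 3"
    using lam_gt by (intro power_strict_mono) auto
  also have "\<dots> = 27 * (r ^ 3)\<^sup>2"
    by (subst lam_eq) (simp add: power_mult_distrib flip: power_mult)
  finally have "(1 / 2)\<^sup>2 < (r ^ 3)\<^sup>2" by (simp add: power2_eq_square)
  hence "1 / 2 < r ^ 3" by (rule power2_less_imp_less) (use r_pos in simp)
  thus ?thesis by simp
qed

lemma r_less_b: "r < b"
proof -
  have "b * lam < b * b\<^sup>2" using b_cubic by (simp add: power3_eq_cube power2_eq_square algebra_simps)
  hence "lam < b\<^sup>2" using b_pos by simp
  hence "r\<^sup>2 < b\<^sup>2" using lam_pos by simp
  thus ?thesis by (rule power2_less_imp_less) (use b_pos in simp)
qed

lemma clp_id: "- b \<le> x \<Longrightarrow> x \<le> b \<Longrightarrow> clp x = x"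
  by (simp add: clp_def)

text \<open>Since \<open>cos t \<ge> -1\<close>, the hypothesis on \<open>b\<close> makes the
  acceleration positive at and above \<open>b\<close>, so no interior maximum can lie there.\<close>

lemma F_pos: "x \<ge> b \<Longrightarrow> F x t > 0"
proof -
  assume "x \<ge> b"
  hence "clp x = b" using b_pos by (simp add: clp_def)
  moreover have "cos t \<ge> -1" by simp
  hence "b ^ 3 - lam * b + cos t > 0" using b_cubic by linarith
  ultimately show ?thesis using e_pos by (simp add: F_def)
qed

text \<open>The local maximum of the cubic beats the forcing, so a solution cannot touch
  \<open>- r\<close> from below at an interior time.\<close>

lemma F_minus_r: "F (- r) t > 0"
proof -
  have c: "clp (- r) = - r" using r_less_b r_pos by (intro clp_id) linarith+
  have "cos t \<ge> -1" by simp
  moreover have "clp (- r) ^ 3 - lam * clp (- r) = 2 * r ^ 3" unfolding c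
    by (subst (2) lam_eq) (simp add: power3_eq_cube power2_eq_square)
  ultimately have "clp (- r) ^ 3 - lam * clp (- r) + cos t > 0" using r_cubed by linarith
  thus ?thesis using e_pos by (simp add: F_def)
qed

lemma clp_minus: "clp (- x) = - clp x"
  using b_pos by (auto simp: clp_def)

text \<open>The two symmetries of the problem: evenness of the cosine, and oddness of the cubic
  combined with the sign change of the cosine under a shift by \<open>pi\<close>.\<close>

lemma F_minus: "F x (- t) = F x t" "F (- x) (t + pi) = - F x t"
  unfolding F_def minus_divide_left by (simp_all add: clp_minus)

lemma abs_clp: "\<bar>clp x\<bar> \<le> b"
  using b_pos by (auto simp: clp_def)

lemma abs_clp_diff: "\<bar>clp x - clp y\<bar> \<le> \<bar>x - y\<bar>"
  by (auto simp: clp_def)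

definition L :: real where "L = (3 * b\<^sup>2 + lam) / e\<^sup>2"

lemma L_nonneg: "L \<ge> 0"
  using lam_pos by (simp add: L_def)

lemma F_lipschitz: "\<bar>F x t - F y t\<bar> \<le> L * \<bar>x - y\<bar>"
proof -
  have "\<bar>(clp x ^ 3 - lam * clp x) - (clp y ^ 3 - lam * clp y)\<bar> \<le> (3 * b\<^sup>2 + lam) * \<bar>clp x - clp y\<bar>"
    using lam_pos abs_clp by (intro cubic_lipschitz) auto
  also have "\<dots> \<le> (3 * b\<^sup>2 + lam) * \<bar>x - y\<bar>"
    using lam_pos abs_clp_diff by (intro mult_left_mono) auto
  finally have "\<bar>(clp x ^ 3 - lam * clp x) - (clp y ^ 3 - lam * clp y)\<bar> / e\<^sup>2 \<le> (3 * b\<^sup>2 + lam) * \<bar>x - y\<bar> / e\<^sup>2"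
    by (rule divide_right_mono) simp
  moreover have "F x t - F y t = ((clp x ^ 3 - lam * clp x) - (clp y ^ 3 - lam * clp y)) / e\<^sup>2"
    by (simp add: F_def diff_divide_distrib add_divide_distrib)
  ultimately show ?thesis using e_pos by (simp add: L_def abs_divide)
qed

lemma F_bounded: "\<bar>F x t\<bar> \<le> L * b + 1 / e\<^sup>2"
proof -
  have "clp 0 = 0" using b_pos by (intro clp_id) auto
  hence F0: "F 0 t = cos t / e\<^sup>2" by (simp add: F_def)
  have "clp (clp x) = clp x" using b_pos by (auto simp: clp_def)
  hence "F x t = F (clp x) t" by (simp add: F_def)
  hence "\<bar>F x t - F 0 t\<bar> \<le> L * \<bar>clp x\<bar>" using F_lipschitz[of "clp x" t 0] by simp
  also have "\<dots> \<le> L * b" using abs_clp L_nonneg by (rule mult_left_mono)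
  finally have "\<bar>F x t - F 0 t\<bar> \<le> L * b" .
  moreover have "\<bar>F 0 t\<bar> \<le> 1 / e\<^sup>2" unfolding F0 abs_divide by (simp add: divide_right_mono)
  ultimately show ?thesis by linarith
qed

lemma F_continuous: "continuous_on UNIV (\<lambda>(x, t). F x t)"
  unfolding F_def clp_def case_prod_unfold using e_pos by (intro continuous_intros) auto

section \<open>Solutions of the truncated equation: symmetries and barriers\<close>

lemma solD:
  assumes "sol u du"
  shows "(u has_real_derivative du t) (at t)" "(du has_real_derivative F (u t) t) (at t)"
  using assms by (auto simp: sol_def)

lemma sol_continuous:
  assumes "sol u du"
  shows "continuous_on A u" "continuous_on A du"
  using DERIV_isCont[OF solD(1)[OF assms]] DERIV_isCont[OF solD(2)[OF assms]]
  by (simp_all add: continuous_at_imp_continuous_on)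

lemma sol_shift:
  assumes "sol u du"
  shows "sol (\<lambda>t. - u (t + pi)) (\<lambda>t. - du (t + pi))"
  unfolding sol_def
proof (intro allI conjI)
  fix t
  show "((\<lambda>t. - u (t + pi)) has_real_derivative - du (t + pi)) (at t)"
    using DERIV_minus[OF iffD1[OF DERIV_shift solD(1)[OF assms]]] .
  have "F (- u (t + pi)) t = - F (u (t + pi)) (t + pi)"
    using F_minus(2)[of "- u (t + pi)" t] by simp
  thus "((\<lambda>t. - du (t + pi)) has_real_derivative F (- u (t + pi)) t) (at t)"
    using DERIV_minus[OF iffD1[OF DERIV_shift solD(2)[OF assms, of "t + pi"]]] by simp
qed

lemma sol_reflect:
  assumes "sol u du"
  shows "sol (\<lambda>t. u (- t)) (\<lambda>t. - du (- t))"
  unfolding sol_def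
proof (intro allI conjI)
  fix t
  show "((\<lambda>t. u (- t)) has_real_derivative - du (- t)) (at t)"
    using solD(1)[OF assms, of "- t"] by (simp flip: DERIV_mirror)
  have "((\<lambda>t. du (- t)) has_real_derivative - F (u (- t)) (- t)) (at t)"
    using solD(2)[OF assms, of "- t"] by (simp flip: DERIV_mirror)
  from DERIV_minus[OF this]
  show "((\<lambda>t. - du (- t)) has_real_derivative F (u (- t)) t) (at t)"
    by (simp add: F_minus)
qed

lemma max_principle:
  assumes u: "sol u du" and "u p \<le> b" "u q \<le> b" "p < t" "t < q"
  shows "u t < b"
proof (rule ccontr)
  assume "\<not> u t < b"
  hence t: "u t \<ge> b" by simp
  obtain m where m: "m \<in> {p..q}" "\<And>s. s \<in> {p..q} \<Longrightarrow> u s \<le> u m"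
    using continuous_attains_sup[of "{p..q}" u] sol_continuous[OF u] assms by fastforce
  \<comment> \<open>If the maximum is attained at an endpoint, it is at most \<open>b\<close> and so
    at most \<open>u t\<close>; then \<open>t\<close> itself is an interior maximum point.\<close>
  have "\<exists>m. p < m \<and> m < q \<and> u m \<ge> b \<and> (\<forall>s\<in>{p..q}. u s \<le> u m)"
  proof (cases "m = p \<or> m = q")
    case True
    hence "u m \<le> b" using assms by auto
    hence "\<forall>s\<in>{p..q}. u s \<le> u t" using m t by force
    thus ?thesis using t assms by blast
  next
    case False
    moreover have "u t \<le> u m" using m(2) assms by simp
    ultimately show ?thesis using m t by (intro exI[of _ m]) auto
  qed
  then obtain m where m: "p < m" "m < q" "u m \<ge> b" "\<forall>s\<in>{p..q}. u s \<le> u m" by blast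
  have "F (u m) m \<le> 0"
    by (rule interior_max_second_derivative[OF solD[OF u] m(1,2)]) (use m in auto)
  thus False using F_pos[OF m(3), of m] by simp
qed

lemma min_principle:
  assumes u: "sol u du" and "u p \<ge> - b" "u q \<ge> - b" "p < t" "t < q"
  shows "u t > - b"
  using max_principle[OF sol_shift[OF u], of "p - pi" "q - pi" "t - pi"] assms by simp

text \<open>Positive acceleration at \<open>b\<close> lifts the solution above \<open>b\<close> even
  from zero slope, and \<open>max_principle\<close> forbids a later return.\<close>

lemma escape_up:
  assumes u: "sol u du" and "u p = b" "du p \<ge> 0" "p < t"
  shows "u t > b"
proof (rule ccontr)
  assume n: "\<not> u t > b"
  obtain d where d: "d > 0" "\<And>s. p < s \<Longrightarrow> s < p + d \<Longrightarrow> u p < u s"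
    using DERIV_second_increasing_right[OF solD[OF u] \<open>du p \<ge> 0\<close>] F_pos assms by (metis order_refl)
  obtain s where s: "p < s" "s < min (p + d) t" using dense[of p "min (p + d) t"] d assms by auto
  show False using max_principle[OF u, of p t s] s d(2)[of s] n assms by auto
qed

lemma escape_down:
  assumes u: "sol u du" and "u p = - b" "du p \<le> 0" "p < t"
  shows "u t < - b"
  using escape_up[OF sol_shift[OF u], of "p - pi" "t - pi"] assms by simp

section \<open>Uniqueness and continuous dependence on the initial value\<close>

lemma sol_dependence:
  assumes u: "sol u du" and v: "sol v dv" and "p \<le> t"
  shows "(u t - v t)\<^sup>2 + (du t - dv t)\<^sup>2
    \<le> ((u p - v p)\<^sup>2 + (du p - dv p)\<^sup>2) * exp ((1 + L) * (t - p))"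
proof (rule DERIV_energy_growth[where ddv = "\<lambda>t. F (u t) t - F (v t) t"])
  show "((\<lambda>t. u t - v t) has_real_derivative du t - dv t) (at t)"
    "((\<lambda>t. du t - dv t) has_real_derivative F (u t) t - F (v t) t) (at t)" for t
    by (intro derivative_intros solD[OF u] solD[OF v])+
qed (use assms L_nonneg F_lipschitz in auto)

lemma sol_unique:
  assumes u: "sol u du" and v: "sol v dv" and p: "u p = v p" "du p = dv p"
  shows "u t = v t"
proof (cases "p \<le> t")
  case True
  thus ?thesis using sol_dependence[OF u v True] p by (simp add: sum_power2_le_zero_iff)
next
  case False
  thus ?thesis using sol_dependence[OF sol_reflect[OF u] sol_reflect[OF v], of "- p" "- t"] p
    by (simp add: sum_power2_le_zero_iff)
qed

text \<open>A pair is chosen so that the solution \<open>U\<close> and its derivative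
  \<open>dU\<close> belong together.\<close>

definition flow where
  "flow a = (SOME p. sol (fst p) (snd p) \<and> fst p 0 = a \<and> snd p 0 = (0 :: real))"

definition U where "U a = fst (flow a)"
definition dU where "dU a = snd (flow a)"

lemma U: "sol (U a) (dU a)" "U a 0 = a" "dU a 0 = 0"
proof -
  obtain u du where "\<And>t. (u has_real_derivative du t) (at t)"
    "\<And>t. (du has_real_derivative F (u t) t) (at t)" "u 0 = a" "du 0 = 0"
    using second_order_ivp_global[OF F_continuous F_bounded F_lipschitz] by blast
  hence "\<exists>p. sol (fst p) (snd p) \<and> fst p 0 = a \<and> snd p 0 = (0 :: real)"
    by (intro exI[of _ "(u, du)"]) (auto simp: sol_def)
  from someI_ex[OF this] show "sol (U a) (dU a)" "U a 0 = a" "dU a 0 = 0"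
    by (auto simp: U_def dU_def flow_def)
qed

lemma even_solution:
  assumes "sol u du" "du 0 = 0"
  shows "u (- t) = u t"
  using sol_unique[OF sol_reflect[OF assms(1)] assms(1), of 0 t] assms by simp

lemma U_dependence: "\<bar>U a t - U c t\<bar> \<le> \<bar>a - c\<bar> * sqrt (exp ((1 + L) * \<bar>t\<bar>))"
proof -
  have *: "\<bar>U a t - U c t\<bar> \<le> \<bar>a - c\<bar> * sqrt (exp ((1 + L) * t))" if "t \<ge> 0" for t
  proof -
    have "(U a t - U c t)\<^sup>2 \<le> (a - c)\<^sup>2 * exp ((1 + L) * t)"
      using sol_dependence[OF U(1)[of a] U(1)[of c] that] by (simp add: U)
        (smt (verit) zero_le_power2)
    hence "sqrt ((U a t - U c t)\<^sup>2) \<le> sqrt ((a - c)\<^sup>2 * exp ((1 + L) * t))"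
      by (rule real_sqrt_le_mono)
    thus ?thesis by (simp add: real_sqrt_mult)
  qed
  show ?thesis
    using *[of "\<bar>t\<bar>"] even_solution[OF U(1) U(3), of a t] even_solution[OF U(1) U(3), of c t]
    by (cases "t \<ge> 0") auto
qed

text \<open>The bound in \<open>U_dependence\<close> is uniform for bounded \<open>t\<close>, so
  joint continuity reduces to continuity of a single solution in time.\<close>

lemma U_continuous: "continuous_on A (\<lambda>(a, t). U a t)"
proof -
  have "isCont (\<lambda>(a, t). U a t) (c, s)" for c s
  proof -
    have "(\<lambda>x. U (fst x) (snd x) - U c (snd x)) \<midarrow>(c, s)\<rightarrow> 0"
    proof (rule Lim_null_comparison)
      show "\<forall>\<^sub>F x in at (c, s). norm (U (fst x) (snd x) - U c (snd x))
          \<le> \<bar>fst x - c\<bar> * sqrt (exp ((1 + L) * \<bar>snd x\<bar>))"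
        using U_dependence by (intro always_eventually) simp
      have "((\<lambda>x. \<bar>fst x - c\<bar> * sqrt (exp ((1 + L) * \<bar>snd x\<bar>))) \<longlongrightarrow>
          \<bar>fst (c, s) - c\<bar> * sqrt (exp ((1 + L) * \<bar>snd (c, s)\<bar>))) (at (c, s))"
        by (intro tendsto_intros)
      thus "((\<lambda>x. \<bar>fst x - c\<bar> * sqrt (exp ((1 + L) * \<bar>snd x\<bar>))) \<longlongrightarrow> 0) (at (c, s))" by simp
    qed
    moreover have "(\<lambda>x. U c (snd x)) \<midarrow>(c, s)\<rightarrow> U c s"
    proof -
      have "isCont (\<lambda>x. U c (snd x)) (c, s)"
        by (rule isCont_o2[of _ _ "U c"])
          (use DERIV_isCont[OF solD(1)[OF U(1)]] in auto)
      thus ?thesis by (simp add: isCont_def)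
    qed
    ultimately have "((\<lambda>x. (U (fst x) (snd x) - U c (snd x)) + U c (snd x)) \<longlongrightarrow> 0 + U c s) (at (c, s))"
      by (rule tendsto_add)
    thus ?thesis by (simp add: isCont_def case_prod_unfold)
  qed
  thus ?thesis by (intro continuous_at_imp_continuous_on) auto
qed

end

section \<open>Intersections with a spike\<close>

text \<open>\<open>W\<close> is the central spike w_0, continued to all times by the truncated
  equation; \<open>al\<close> is its minimum and \<open>S\<close> the half-length of its
  interval.\<close>

locale spike_solution = truncated_equation +
  fixes al S :: real and W dW :: "real \<Rightarrow> real"
  assumes W_sol: "sol W dW" and W_0: "W 0 = al" and dW_0: "dW 0 = 0"
    and al_gt: "- b < al" and al_less: "al < - r"
    and S_pos: "0 < S" and S_less: "S < pi / 2"
    and W_mono: "strict_mono_on {0..S} W" and W_S: "W S = b"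
begin

lemma W_even: "W (- t) = W t"
  by (rule even_solution[OF W_sol dW_0])

lemma dW_nonneg:
  assumes "0 \<le> t" "t \<le> S"
  shows "dW t \<ge> 0"
proof (rule ccontr)
  assume "\<not> dW t \<ge> 0"
  hence neg: "dW t < 0" by simp
  show False
  proof (cases "t < S")
    case True
    obtain d where d: "d > 0" "\<And>h. 0 < h \<Longrightarrow> h < d \<Longrightarrow> W t > W (t + h)"
      using DERIV_neg_dec_right[OF solD(1)[OF W_sol] neg] by blast
    obtain h where "0 < h" "h < min d (S - t)" using dense[of 0 "min d (S - t)"] d True by auto
    thus False using d(2)[of h] strict_mono_onD[OF W_mono, of t "t + h"] assms by auto
  next
    case False
    hence t: "t = S" using assms by simp
    obtain d where d: "d > 0" "\<And>h. 0 < h \<Longrightarrow> h < d \<Longrightarrow> W t < W (t - h)"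
      using DERIV_neg_dec_left[OF solD(1)[OF W_sol] neg] by blast
    obtain h where "0 < h" "h < min d S" using dense[of 0 "min d S"] d S_pos by auto
    thus False using d(2)[of h] strict_mono_onD[OF W_mono, of "t - h" t] t by auto
  qed
qed

lemma W_gt_b: "\<bar>t\<bar> > S \<Longrightarrow> W t > b"
  using escape_up[OF W_sol W_S dW_nonneg, of "\<bar>t\<bar>"] S_pos W_even[of t] by (cases "t \<ge> 0") auto

lemma W_less: "0 \<le> t \<Longrightarrow> t < s \<Longrightarrow> s \<le> S \<Longrightarrow> W t < W s"
  using strict_mono_onD[OF W_mono, of t s] by auto

lemma W_le: "0 \<le> t \<Longrightarrow> t \<le> s \<Longrightarrow> s \<le> S \<Longrightarrow> W t \<le> W s"
  using W_less[of t s] by (cases "t = s") auto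

lemma W_le_b: "\<bar>t\<bar> \<le> S \<Longrightarrow> W t \<le> b"
  using W_le[of "\<bar>t\<bar>" S] W_even[of t] W_S by (cases "t \<ge> 0") auto

lemma W_ge: "al \<le> W t"
proof -
  have "al < b" using al_less r_less_b r_pos by linarith
  hence "al \<le> W \<bar>t\<bar>"
    using W_le[of 0 "\<bar>t\<bar>"] W_gt_b[of "\<bar>t\<bar>"] W_0
    by (cases "\<bar>t\<bar> \<le> S") auto
  thus ?thesis using W_even[of t] by (cases "t \<ge> 0") auto
qed

text \<open>Equal slopes mean \<open>u = W\<close>. Otherwise, if \<open>u S < b\<close>, then
  \<open>u\<close> runs above \<open>W\<close> and meets it again at a first time \<open>t1\<close>.
  Comparison at equal heights shows that \<open>u\<close> is faster, so it rises throughout and is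
  still steeper than \<open>W\<close> at \<open>t1\<close>, where it would have to come down onto
  \<open>W\<close>.\<close>

lemma upward_crossing:
  assumes u: "sol u du" and t0: "0 \<le> t0" "t0 \<le> S" "u t0 = W t0" "du t0 \<ge> dW t0"
  shows "u S \<ge> b"
proof (cases "du t0 = dW t0")
  case True
  thus ?thesis using sol_unique[OF u W_sol t0(3), of S] W_S by simp
next
  case False
  hence gt: "du t0 > dW t0" using t0 by simp
  have dW0: "dW t0 \<ge> 0" using dW_nonneg t0 by simp
  show ?thesis
  proof (rule ccontr)
    assume "\<not> u S \<ge> b"
    hence uS: "u S < b" by simp
    have "t0 < S" using t0 uS W_S by (cases "t0 = S") auto
    have ub: "u t \<le> b" if "t0 \<le> t" "t \<le> S" for t
    proof -
      have "u t0 \<le> b" using t0 W_le_b[of t0] by simp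
      thus ?thesis using max_principle[OF u, of t0 S t] uS that by (cases "t = t0 \<or> t = S") auto
    qed
    have D: "((\<lambda>t. u t - W t) has_real_derivative du t - dW t) (at t)" for t
      by (intro derivative_intros solD[OF u] solD[OF W_sol])
    obtain d where d: "d > 0" "\<And>h. h > 0 \<Longrightarrow> h < d \<Longrightarrow> u t0 - W t0 < u (t0 + h) - W (t0 + h)"
      using DERIV_pos_inc_right[OF D[of t0]] gt by auto
    obtain h where h: "0 < h" "h < min d (S - t0)" using dense[of 0 "min d (S - t0)"] d \<open>t0 < S\<close> by auto
    obtain t1 where t1: "t0 + h < t1" "t1 \<le> S" "W t1 - u t1 = 0"
      and neg: "\<And>s. t0 + h \<le> s \<Longrightarrow> s < t1 \<Longrightarrow> W s - u s < 0"
    proof (rule first_nonneg[of "t0 + h" S "\<lambda>t. W t - u t"])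
      show "continuous_on {t0 + h..S} (\<lambda>t. W t - u t)"
        by (intro continuous_intros sol_continuous[OF u] sol_continuous[OF W_sol])
    qed (use h d(2)[of h] t0 uS W_S in auto)
    have above: "u t \<ge> W t" if "t0 \<le> t" "t \<le> t1" for t
      using d(2)[of "t - t0"] neg[of t] that t1 t0(3) h
      by (cases "t = t0 \<or> t = t1"; cases "t < t0 + h") auto
    have u_clp: "clp (u t) = u t" "clp (W t) = W t" if "t0 \<le> t" "t \<le> t1" for t
      using above[OF that] ub[of t] that W_ge[of t] W_le_b[of t] al_gt t1 t0(1) by (auto intro!: clp_id)
    have W_clp: "clp (W t) = W t" if "0 \<le> t" "t \<le> S" for t
      using that W_ge[of t] W_le_b[of t] al_gt by (auto intro!: clp_id)
    \<comment> \<open>The energy with the forcing counted as potential: along solutions inside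
      \<open>[- b, b]\<close> only the explicit time dependence contributes, which leaves
      \<open>sin t * v t\<close>.\<close>
    define H where "H u du t = e\<^sup>2 * (du t)\<^sup>2 / 2 - (u t ^ 4 / 4 - lam * (u t)\<^sup>2 / 2) - cos t * u t"
      for u du :: "real \<Rightarrow> real" and t
    have DH: "(H v dv has_real_derivative sin t * v t) (at t)"
      if v: "sol v dv" "clp (v t) = v t" for v dv t
    proof -
      have "F (v t) t * e\<^sup>2 = v t ^ 3 - lam * v t + cos t"
        using v(2) e_pos by (simp add: F_def)
      hence "e\<^sup>2 * (2 * dv t * F (v t) t) / 2 - (4 * v t ^ 3 * dv t / 4 - lam * (2 * v t * dv t) / 2)
          - (cos t * dv t - sin t * v t) = sin t * v t"
        by (simp add: algebra_simps) algebra
      thus ?thesis unfolding H_def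
        by (auto intro!: derivative_eq_intros solD[OF v(1)] simp: field_simps)
    qed
    have sin_nn: "sin t \<ge> 0" if "0 \<le> t" "t \<le> S" for t
      using that S_less by (intro sin_ge_zero) auto
    \<comment> \<open>At equal height \<open>u\<close> is faster than \<open>W\<close>: it arrives earlier, when the forcing is larger.\<close>
    have faster: "(dW t3)\<^sup>2 < (du t2)\<^sup>2"
      if t2: "t0 \<le> t2" "t2 \<le> t1" and t3: "t2 \<le> t3" "t3 \<le> S" "W t3 = u t2" for t2 t3
    proof -
      have 1: "H u du t0 - H W dW t0 \<le> H u du t2 - H W dW t2"
      proof (rule DERIV_nonneg_imp_nondecreasing[OF t2(1)])
        fix t assume t: "t0 \<le> t" "t \<le> t2"
        have "((\<lambda>t. H u du t - H W dW t) has_real_derivative sin t * u t - sin t * W t) (at t)"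
          using t t2 by (intro derivative_intros DH u W_sol u_clp) auto
        moreover have "sin t * u t - sin t * W t \<ge> 0"
          using above[of t] sin_nn[of t] t t2 t1 t0 by (simp add: mult_left_mono)
        ultimately show "\<exists>y. ((\<lambda>t. H u du t - H W dW t) has_real_derivative y) (at t) \<and> y \<ge> 0"
          by blast
      qed
      \<comment> \<open>The height \<open>u t2\<close> is held fixed: \<open>W\<close> does not
        exceed it on \<open>[t2, t3]\<close>. At equal heights all potential terms and the cosine
        terms cancel in the end, leaving the kinetic ones.\<close>
      have 2: "H W dW t3 + u t2 * cos t3 \<le> H W dW t2 + u t2 * cos t2"
      proof (rule DERIV_nonpos_imp_nonincreasing[OF t3(1)])
        fix t assume t: "t2 \<le> t" "t \<le> t3"
        have "((\<lambda>t. H W dW t + u t2 * cos t) has_real_derivative sin t * W t + u t2 * (- sin t)) (at t)"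
          using t t2 t3 t0 by (auto intro!: derivative_eq_intros DH W_sol W_clp)
        moreover have "sin t * W t + u t2 * (- sin t) \<le> 0"
          using W_le[of t t3] sin_nn[of t] t t2 t3 t0 by (simp add: mult_left_mono mult.commute[of "u t2"])
        ultimately show "\<exists>y. ((\<lambda>t. H W dW t + u t2 * cos t) has_real_derivative y) (at t) \<and> y \<le> 0"
          by blast
      qed
      have "(dW t0)\<^sup>2 < (du t0)\<^sup>2" using gt dW0 by (intro power_strict_mono) auto
      hence "H W dW t0 < H u du t0" using t0(3) e_pos by (simp add: H_def)
      hence "H W dW t3 + u t2 * cos t3 < H u du t2 + u t2 * cos t2" using 1 2 by linarith
      hence "e\<^sup>2 * (dW t3)\<^sup>2 < e\<^sup>2 * (du t2)\<^sup>2" using t3(3) by (simp add: H_def algebra_simps)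
      thus ?thesis using e_pos by simp
    qed
    \<comment> \<open>\<open>W\<close> reaches the height \<open>u t\<close> at time
      \<open>t\<close> or later, and a zero of \<open>du\<close> would contradict the strict
      inequality of the squares.\<close>
    have nz: "du t \<noteq> 0" if t: "t0 \<le> t" "t \<le> t1" for t
    proof -
      have "\<exists>s\<ge>t. s \<le> S \<and> W s = u t"
        using IVT'[of W t "u t" S] above[OF t] ub[of t] t t1 W_S sol_continuous(1)[OF W_sol] by auto
      then obtain s where "s \<ge> t" "s \<le> S" "W s = u t" by blast
      from faster[OF t this] show ?thesis by (auto simp: not_less)
    qed
    have "du t1 > 0"
    proof (rule ccontr)
      assume "\<not> du t1 > 0"
      hence "\<exists>t\<ge>t0. t \<le> t1 \<and> du t = 0"
        using IVT2'[of du t1 0 t0] gt dW0 t1 h sol_continuous(2)[OF u] by auto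
      thus False using nz by blast
    qed
    moreover have "(dW t1)\<^sup>2 < (du t1)\<^sup>2" using faster[of t1 t1] t1 h by simp
    ultimately have "du t1 - dW t1 > 0" by (smt (verit) power2_less_imp_less)
    \<comment> \<open>A positive slope of \<open>u - W\<close> at its zero \<open>t1\<close> puts
      \<open>u\<close> below \<open>W\<close> just before, against \<open>above\<close>.\<close>
    from DERIV_pos_inc_left[OF D this]
    obtain k where k: "k > 0" "\<And>h. h > 0 \<Longrightarrow> h < k \<Longrightarrow> u (t1 - h) - W (t1 - h) < u t1 - W t1" by blast
    obtain g where "0 < g" "g < min k (t1 - t0)" using dense[of 0 "min k (t1 - t0)"] k t1 h by auto
    thus False using k(2)[of g] above[of "t1 - g"] t1(3) by auto
  qed
qed

text \<open>\<open>upward_crossing\<close> needs a contact point with \<open>du \<ge> dW\<close>: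
  the first contact after \<open>u\<close> has been strictly below \<open>W\<close>, or else
  \<open>t1\<close> itself.\<close>

lemma crosses_up:
  assumes u: "sol u du" and "0 \<le> t1" "t1 < t" "t \<le> S" "u t1 \<le> W t1" "u t \<ge> W t"
  shows "u S \<ge> b"
proof -
  have D: "((\<lambda>t. u t - W t) has_real_derivative du t - dW t) (at t)" for t
    by (intro derivative_intros solD[OF u] solD[OF W_sol])
  have c: "continuous_on A (\<lambda>t. u t - W t)" for A
    by (intro continuous_intros sol_continuous[OF u] sol_continuous[OF W_sol])
  show ?thesis
  proof (cases "\<exists>s\<ge>t1. s < t \<and> u s < W s")
    case True
    then obtain s where s: "t1 \<le> s" "s < t" "u s < W s" by blast
    obtain t0 where t0: "s < t0" "t0 \<le> t" "u t0 - W t0 = 0"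
      and neg: "\<And>x. s \<le> x \<Longrightarrow> x < t0 \<Longrightarrow> u x - W x < 0"
      using first_nonneg[OF c, of s t] s assms by auto
    have "du t0 \<ge> dW t0"
    proof (rule ccontr)
      assume "\<not> du t0 \<ge> dW t0"
      hence "du t0 - dW t0 < 0" by simp
      from DERIV_neg_dec_left[OF D this]
      obtain k where k: "k > 0" "\<And>h. h > 0 \<Longrightarrow> h < k \<Longrightarrow> u t0 - W t0 < u (t0 - h) - W (t0 - h)" by blast
      obtain g where "0 < g" "g < min k (t0 - s)" using dense[of 0 "min k (t0 - s)"] k t0 by auto
      thus False using k(2)[of g] neg[of "t0 - g"] t0(3) by auto
    qed
    thus ?thesis using upward_crossing[OF u, of t0] t0 s assms by simp
  next
    case False
    hence above: "u s \<ge> W s" if "t1 \<le> s" "s < t" for s using that by force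
    have eq: "u t1 = W t1" using above[of t1] assms by simp
    have "du t1 \<ge> dW t1"
    proof (rule ccontr)
      assume "\<not> du t1 \<ge> dW t1"
      hence "du t1 - dW t1 < 0" by simp
      from DERIV_neg_dec_right[OF D this]
      obtain k where k: "k > 0" "\<And>h. h > 0 \<Longrightarrow> h < k \<Longrightarrow> u t1 - W t1 > u (t1 + h) - W (t1 + h)" by blast
      obtain g where "0 < g" "g < min k (t - t1)" using dense[of 0 "min k (t - t1)"] k assms by auto
      thus False using k(2)[of g] above[of "t1 + g"] eq by auto
    qed
    thus ?thesis using upward_crossing[OF u, of t1] eq assms by simp
  qed
qed

section \<open>Counting the meetings with the spike\<close>

lemma below_W_right:
  assumes u: "sol u du" and "u 0 \<le> al" "u S < b" "0 < t" "t \<le> S"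
  shows "u t < W t"
  using crosses_up[OF u, of 0 t] assms W_0 by force

lemma below_W_left:
  assumes u: "sol u du" and "u 0 \<le> al" "u (- S) < b" "- S \<le> t" "t < 0"
  shows "u t < W t"
  using below_W_right[OF sol_reflect[OF u], of "- t"] assms W_even[of t] by simp

text \<open>The sign of the slope at \<open>0\<close> selects the half of the spike along which
  \<open>u\<close> escapes; a negative slope is treated by time reversal.\<close>

lemma not_at_bottom:
  assumes u: "sol u du" and "u S < b" "u (- S) < b"
  shows "u 0 \<noteq> al"
proof
  assume al: "u 0 = al"
  show False
  proof (cases "du 0 \<ge> 0")
    case True
    thus False using upward_crossing[OF u, of 0] al W_0 dW_0 S_pos assms by simp
  next
    case False
    thus False using upward_crossing[OF sol_reflect[OF u], of 0] al W_0 dW_0 S_pos assms by simp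
  qed
qed

lemma no_intersection:
  assumes u: "sol u du" and "u 0 \<le> al" "u S < b" "u (- S) < b"
  shows "{t \<in> {- S..S}. u t = W t} = {}"
proof -
  have "u 0 \<noteq> W 0" using not_at_bottom[OF u] assms W_0 by simp
  moreover have "u t \<noteq> W t" if "- S \<le> t" "t \<le> S" "t \<noteq> 0" for t
    using below_W_right[OF u, of t] below_W_left[OF u, of t] that assms by (cases "t > 0") auto
  ultimately show ?thesis by (metis (mono_tags, lifting) Collect_empty_eq atLeastAtMost_iff)
qed

text \<open>Existence is the intermediate value theorem. For two meetings, \<open>crosses_up\<close>
  applies with equality at both and forces \<open>u S \<ge> b\<close>.\<close>

lemma one_intersection_right:
  assumes u: "sol u du" and "u 0 > al" "u S < b"
  shows "\<exists>!t. 0 < t \<and> t \<le> S \<and> u t = W t"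
proof (rule ex_ex1I)
  have "\<exists>t\<ge>0. t \<le> S \<and> W t - u t = 0"
    using assms W_0 W_S S_pos
    by (intro IVT') (auto intro!: continuous_intros sol_continuous[OF u] sol_continuous[OF W_sol])
  then obtain t where "t \<ge> 0" "t \<le> S" "u t = W t" by auto
  thus "\<exists>t. 0 < t \<and> t \<le> S \<and> u t = W t" using assms W_0 by (intro exI[of _ t]) (cases "t = 0"; auto)
  fix t s assume "0 < t \<and> t \<le> S \<and> u t = W t" "0 < s \<and> s \<le> S \<and> u s = W s"
  thus "t = s" using crosses_up[OF u, of t s] crosses_up[OF u, of s t] assms
    by (cases t s rule: linorder_cases) auto
qed

lemma two_intersections:
  assumes u: "sol u du" and "u 0 > al" "u S < b" "u (- S) < b"
  shows "card {t \<in> {- S..S}. u t = W t} = 2"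
proof -
  obtain p where p: "0 < p" "p \<le> S" "u p = W p" "\<And>t. 0 < t \<Longrightarrow> t \<le> S \<Longrightarrow> u t = W t \<Longrightarrow> t = p"
    using one_intersection_right[OF u] assms by blast
  have "\<exists>!t. 0 < t \<and> t \<le> S \<and> u (- t) = W t"
    using one_intersection_right[OF sol_reflect[OF u]] assms by simp
  then obtain q where q: "0 < q" "q \<le> S" "u (- q) = W q" "\<And>t. 0 < t \<Longrightarrow> t \<le> S \<Longrightarrow> u (- t) = W t \<Longrightarrow> t = q"
    by blast
  have "t = p \<or> t = - q" if t: "- S \<le> t" "t \<le> S" "u t = W t" for t
  proof (cases t "0 :: real" rule: linorder_cases)
    case less
    thus ?thesis using q(4)[of "- t"] t W_even[of t] by simp
  next
    case equal
    thus ?thesis using t(3) assms(2) W_0 by simp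
  next
    case greater
    thus ?thesis using p(4)[of t] t by simp
  qed
  moreover have "p \<in> {t \<in> {- S..S}. u t = W t}" using p(1-3) by simp
  moreover have "- q \<in> {t \<in> {- S..S}. u t = W t}" using q(1-3) W_even[of q] by simp
  ultimately have "{t \<in> {- S..S}. u t = W t} = {p, - q}" by auto
  moreover have "p \<noteq> - q" using p(1) q(1) by simp
  ultimately show ?thesis by simp
qed

end

section \<open>Shooting\<close>

text \<open>\<open>r'\<close> is the first point where \<open>f\<close> reaches \<open>hi\<close>,
  and \<open>l'\<close> the last point before it where \<open>f\<close> equals \<open>lo\<close>;
  the latter is found as a first point after reflection.\<close>

lemma crossing_subinterval:
  fixes f :: "real \<Rightarrow> real"
  assumes f: "continuous_on {l..r} f" and "l \<le> r" "f l \<le> lo" "f r \<ge> hi" "lo < hi"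
  obtains l' r' where "l \<le> l'" "l' \<le> r'" "r' \<le> r" "f l' = lo" "f r' = hi"
    "\<And>x. l' \<le> x \<Longrightarrow> x \<le> r' \<Longrightarrow> lo \<le> f x \<and> f x \<le> hi"
proof -
  have "l \<noteq> r" using assms by auto
  hence "l < r" using \<open>l \<le> r\<close> by simp
  moreover have "continuous_on {l..r} (\<lambda>x. f x - hi)" by (intro continuous_intros f)
  moreover have "f l - hi < 0" "f r - hi \<ge> 0" using assms by auto
  ultimately obtain r' where r': "l < r'" "r' \<le> r" "f r' - hi = 0"
    and below: "\<And>x. l \<le> x \<Longrightarrow> x < r' \<Longrightarrow> f x - hi < 0"
    using first_nonneg[of l r "\<lambda>x. f x - hi"] by blast
  have "continuous_on {- r'..- l} (\<lambda>x. lo - f (- x))"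
    using r' by (intro continuous_intros continuous_on_compose2[OF f]) auto
  moreover have "- r' < - l" "lo - f (- (- r')) < 0" "lo - f (- (- l)) \<ge> 0" using r' assms by auto
  ultimately obtain t where t: "- r' < t" "t \<le> - l" "lo - f (- t) = 0"
    and above: "\<And>x. - r' \<le> x \<Longrightarrow> x < t \<Longrightarrow> lo - f (- x) < 0"
    using first_nonneg[of "- r'" "- l" "\<lambda>x. lo - f (- x)"] by blast
  show ?thesis
  proof (rule that[of "- t" r'])
    fix x assume "- t \<le> x" "x \<le> r'"
    thus "lo \<le> f x \<and> f x \<le> hi"
      using below[of x] above[of "- x"] t r' by (cases "x = - t"; cases "x = r'") auto
  qed (use t r' in auto)
qed

lemma continuous_gt_nearby:
  fixes f :: "real \<Rightarrow> real"
  assumes "continuous_on A f" "c \<in> A" "f c > k"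
  obtains \<delta> where "\<delta> > 0" "\<And>x. x \<in> A \<Longrightarrow> \<bar>x - c\<bar> < \<delta> \<Longrightarrow> f x > k"
proof -
  obtain \<delta> where \<delta>: "\<delta> > 0" "\<forall>x\<in>A. dist x c < \<delta> \<longrightarrow> dist (f x) (f c) < f c - k"
    using assms unfolding continuous_on_iff by (metis diff_gt_0_iff_gt)
  show ?thesis
  proof (rule that[OF \<delta>(1)])
    fix x assume "x \<in> A" "\<bar>x - c\<bar> < \<delta>"
    hence "dist (f x) (f c) < f c - k" using \<delta>(2) by (simp add: dist_real_def)
    thus "f x > k" by (simp add: dist_real_def abs_less_iff)
  qed
qed

lemma continuous_le_left_limit:
  fixes f :: "real \<Rightarrow> real"
  assumes f: "continuous_on {p..q} f" and "p < c" "c \<le> q" "\<And>a. p \<le> a \<Longrightarrow> a < c \<Longrightarrow> f a \<le> k"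
  shows "f c \<le> k"
proof (rule ccontr)
  assume "\<not> f c \<le> k"
  then obtain d where d: "d > 0" "\<And>x. x \<in> {p..q} \<Longrightarrow> \<bar>x - c\<bar> < d \<Longrightarrow> f x > k"
    using continuous_gt_nearby[OF f, of c k] assms by auto
  obtain a where "max p (c - d) < a" "a < c" using dense[of "max p (c - d)" c] d assms by auto
  thus False using d(2)[of a] assms(3) assms(4)[of a] by auto
qed

lemma continuous_gt_right:
  fixes f :: "real \<Rightarrow> real"
  assumes f: "continuous_on {p..q} f" and "p \<le> c" "c < d" "d \<le> q" "f c > k"
  obtains a where "c < a" "a < d" "f a > k"
proof -
  obtain e where e: "e > 0" "\<And>x. x \<in> {p..q} \<Longrightarrow> \<bar>x - c\<bar> < e \<Longrightarrow> f x > k"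
    using continuous_gt_nearby[OF f, of c k] assms by auto
  obtain a where a: "c < a" "a < min d (c + e)" using dense[of c "min d (c + e)"] e assms by auto
  moreover have "f a > k" by (rule e(2)) (use a assms in auto)
  ultimately show ?thesis using that by simp
qed

context spike_solution
begin

lemma al_less_b: "al < b" and minus_b_less_r: "- b < - r" and al_neg: "al < 0"
  using al_less r_less_b r_pos al_gt by linarith+

text \<open>At time \<open>S\<close> the solution is at least \<open>b\<close> by
  \<open>upward_crossing\<close>; a later value at or below \<open>b\<close> would contradict
  \<open>max_principle\<close>.\<close>

lemma leaves_up:
  assumes u: "sol u du" and "u 0 = al" "du 0 \<ge> 0" "S < T"
  shows "u T > b"
proof (rule ccontr)
  assume "\<not> u T > b"
  hence "u S < b" using max_principle[OF u, of 0 T S] assms S_pos al_less_b by simp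
  thus False using upward_crossing[OF u, of 0] assms S_pos W_0 dW_0 by simp
qed

lemma S_less_pi: "S < pi"
  using S_less pi_gt_zero by linarith

text \<open>An interior contact with \<open>- r\<close> would be a maximum with positive second
  derivative, by \<open>F_minus_r\<close>.\<close>

lemma touches_at_end:
  assumes u: "sol u du" and "\<And>t. 0 \<le> t \<Longrightarrow> t \<le> T \<Longrightarrow> u t \<le> - r" "u 0 < - r" "0 \<le> t" "t \<le> T" "u t = - r"
  shows "t = T"
proof (rule ccontr)
  assume "t \<noteq> T"
  moreover have "t \<noteq> 0" using assms by auto
  ultimately have "F (u t) t \<le> 0"
    by (intro interior_max_second_derivative[OF solD[OF u], of 0 t T]) (use assms in auto)
  thus False using F_minus_r[of t] assms by simp
qed

end

text \<open>The family is abstract so that it serves both orientations of a parameter interval. The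
  slope conditions make the two end members leave \<open>[- b, b]\<close> in forward time, one
  downwards and one upwards.\<close>

locale rising_family = spike_solution +
  fixes v dv :: "real \<Rightarrow> real \<Rightarrow> real" and p q :: real
  assumes p_le_q: "p \<le> q"
    and v_sol: "\<And>a. p \<le> a \<Longrightarrow> a \<le> q \<Longrightarrow> sol (v a) (dv a)"
    and v_cont: "continuous_on ({p..q} \<times> UNIV) (\<lambda>(a, t). v a t)"
    and v_0: "\<And>a. p \<le> a \<Longrightarrow> a \<le> q \<Longrightarrow> - b \<le> v a 0 \<and> v a 0 \<le> al"
    and v_p: "v p 0 = - b" "dv p 0 \<le> 0"
    and v_q: "v q 0 = al" "dv q 0 \<ge> 0"
begin

section \<open>The three moves of the shooting argument\<close>

lemma v_cont_a: "continuous_on {p..q} (\<lambda>a. v a t)"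
proof -
  have "continuous_on {p..q} (\<lambda>a. (\<lambda>(a, t). v a t) (a, t))"
    by (rule continuous_on_compose2[OF v_cont]) (auto intro!: continuous_intros)
  thus ?thesis by simp
qed

lemma v_p_less: "t > 0 \<Longrightarrow> v p t < - b"
  using escape_down[OF v_sol v_p] p_le_q by simp

lemma v_q_gt: "t > S \<Longrightarrow> v q t > b"
  using leaves_up[OF v_sol v_q] p_le_q by simp

text \<open>The pairs \<open>(a, t)\<close> with \<open>v a t \<ge> - r\<close> form a compact set,
  whose projection to the parameter axis has a least element.\<close>

lemma first_time_parameter:
  assumes "p \<le> c" "c \<le> d" "d \<le> q" "\<exists>t\<in>{0..T}. v d t \<ge> - r"
  obtains a s where "c \<le> a" "a \<le> d" "s \<in> {0..T}" "v a s \<ge> - r"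
    "\<And>a' t. c \<le> a' \<Longrightarrow> a' < a \<Longrightarrow> t \<in> {0..T} \<Longrightarrow> v a' t < - r"
proof -
  define K where "K = {x \<in> {c..d} \<times> {0..T}. (\<lambda>(a, t). v a t) x \<in> {- r..}}"
  have cont: "continuous_on ({c..d} \<times> {0..T}) (\<lambda>(a, t). v a t)"
    by (rule continuous_on_subset[OF v_cont]) (use assms in auto)
  have "closed K"
    using continuous_closed_preimage[OF cont, of "{- r..}"] closed_Times[of "{c..d}" "{0..T}"]
    by (simp add: K_def vimage_def Int_def)
  moreover have "bounded K"
    by (rule bounded_subset[OF bounded_Times[of "{c..d}" "{0..T}"]]) (auto simp: K_def)
  ultimately have "compact (fst ` K)"
    by (intro compact_continuous_image) (auto simp: compact_eq_bounded_closed intro!: continuous_intros)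
  moreover have "fst ` K \<noteq> {}"
  proof -
    obtain t where "t \<in> {0..T}" "v d t \<ge> - r" using assms(4) by blast
    hence "(d, t) \<in> K" using assms(2) by (simp add: K_def)
    thus ?thesis by blast
  qed
  ultimately obtain a where a: "a \<in> fst ` K" "\<And>x. x \<in> fst ` K \<Longrightarrow> a \<le> x"
    using compact_attains_inf[of "fst ` K"] by blast
  then obtain s where s: "(a, s) \<in> K" by auto
  show ?thesis
  proof (rule that[of a s])
    fix a' t assume t: "c \<le> a'" "a' < a" "t \<in> {0..T}"
    have "(a', t) \<notin> K" using a(2)[of a'] t(2) by force
    thus "v a' t < - r" using t s by (auto simp: K_def)
  qed (use s in \<open>auto simp: K_def\<close>)
qed

text \<open>At time \<open>pi\<close> the end members lie below \<open>- b\<close> and above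
  \<open>b\<close>, so some stretch between covers \<open>[- al, b]\<close>; the turn by
  \<open>pi\<close> makes this \<open>[- b, al]\<close>.\<close>

lemma move_cross:
  obtains l r where "p \<le> l" "l \<le> r" "r \<le> q" "v l pi = - al" "v r pi = b"
    "\<And>a. l \<le> a \<Longrightarrow> a \<le> r \<Longrightarrow> - al \<le> v a pi \<and> v a pi \<le> b"
  by (rule crossing_subinterval[OF v_cont_a[of pi] p_le_q, of "- al" b])
    (use v_p_less[of pi] v_q_gt[of pi] S_less_pi al_gt b_pos al_neg in force)+

text \<open>\<open>c\<close> is the first parameter whose solution reaches \<open>- r\<close> on
  \<open>[0, 2 * pi]\<close>. By continuity that solution stays at or below \<open>- r\<close>, so
  it touches only at the final time. Over \<open>[p, c]\<close> the values at \<open>2 * pi\<close>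
  thus run from below \<open>- b\<close> up to \<open>- r > al\<close>.\<close>

lemma move_stay:
  obtains l h where "p \<le> l" "l \<le> h" "h \<le> q" "v l (2 * pi) = - b" "v h (2 * pi) = al"
    "\<And>a. l \<le> a \<Longrightarrow> a \<le> h \<Longrightarrow> - b \<le> v a (2 * pi) \<and> v a (2 * pi) \<le> al"
    "\<And>a t. l \<le> a \<Longrightarrow> a \<le> h \<Longrightarrow> t \<in> {0..2 * pi} \<Longrightarrow> v a t < - r"
proof -
  have "v q (2 * pi) > b" by (rule v_q_gt) (use S_less_pi pi_gt_zero in linarith)
  moreover have "b > - r" using b_pos r_pos by linarith
  ultimately have "v q (2 * pi) \<ge> - r" by linarith
  hence "\<exists>t\<in>{0..2 * pi}. v q t \<ge> - r" by (intro bexI[of _ "2 * pi"]) auto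
  from first_time_parameter[OF order_refl p_le_q order_refl this]
  obtain c s where c: "p \<le> c" "c \<le> q" "s \<in> {0..2 * pi}" "v c s \<ge> - r"
    and below: "\<And>a t. p \<le> a \<Longrightarrow> a < c \<Longrightarrow> t \<in> {0..2 * pi} \<Longrightarrow> v a t < - r" by blast
  have "p \<noteq> c" using v_p_less[of s] v_p c(3,4) minus_b_less_r by (cases "s = 0") auto
  hence pc: "p < c" using c by simp
  have le: "v c t \<le> - r" if "t \<in> {0..2 * pi}" for t
    by (rule continuous_le_left_limit[OF v_cont_a pc c(2)]) (use below that in force)
  have "s = 2 * pi"
    by (rule touches_at_end[OF v_sol[OF c(1,2)]]) (use le c v_0[of c] al_less in force)+
  hence vc: "v c (2 * pi) = - r" using le[of s] c by simp
  have "continuous_on {p..c} (\<lambda>a. v a (2 * pi))"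
    by (rule continuous_on_subset[OF v_cont_a]) (use c in auto)
  then obtain l h where lh: "p \<le> l" "l \<le> h" "h \<le> c" "v l (2 * pi) = - b" "v h (2 * pi) = al"
    "\<And>a. l \<le> a \<Longrightarrow> a \<le> h \<Longrightarrow> - b \<le> v a (2 * pi) \<and> v a (2 * pi) \<le> al"
    by (rule crossing_subinterval[where lo = "- b" and hi = al])
      (use v_p_less[of "2 * pi"] vc al_less al_gt c in auto)
  \<comment> \<open>The strict bound by \<open>- r\<close> is known only for parameters smaller than
    \<open>c\<close>.\<close>
  have "h \<noteq> c" using lh(5) vc al_less by auto
  thus ?thesis using that[of l h] lh below c by force
qed

text \<open>\<open>d\<close> is the first parameter that hits the peak \<open>- al\<close> of the
  next spike at time \<open>pi\<close>; its solution must then escape through \<open>- b\<close>.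
  \<open>c < d\<close> is the last parameter in \<open>[p, d]\<close> whose solution never exceeds
  \<open>- r\<close>; it ends at \<open>- r\<close>. Parameters strictly between exceed
  \<open>- r\<close> and pass below the peak, while the value at \<open>2 * pi\<close> sweeps over
  \<open>[- b, al]\<close>.\<close>

lemma move_spike:
  obtains l h where "p \<le> l" "l \<le> h" "h \<le> q" "v l (2 * pi) = al" "v h (2 * pi) = - b"
    "\<And>a. l \<le> a \<Longrightarrow> a \<le> h \<Longrightarrow> - b \<le> v a (2 * pi) \<and> v a (2 * pi) \<le> al"
    "\<And>a. l \<le> a \<Longrightarrow> a \<le> h \<Longrightarrow> v a pi < - al"
    "\<And>a. l \<le> a \<Longrightarrow> a \<le> h \<Longrightarrow> \<exists>t\<in>{0<..<2 * pi}. v a t > - r"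
proof -
  have "v p pi < - b" "v q pi > b" using v_p_less v_q_gt S_less_pi by auto
  hence "p < q" using p_le_q b_pos by (cases "p = q") auto
  moreover have "continuous_on {p..q} (\<lambda>a. v a pi + al)" by (intro continuous_intros v_cont_a)
  moreover have "v p pi + al < 0" "v q pi + al \<ge> 0"
    using \<open>v p pi < - b\<close> \<open>v q pi > b\<close> al_neg al_gt b_pos by linarith+
  ultimately obtain d where d: "p < d" "d \<le> q" "v d pi + al = 0"
    and below: "\<And>a. p \<le> a \<Longrightarrow> a < d \<Longrightarrow> v a pi + al < 0"
    using first_nonneg[of p q "\<lambda>a. v a pi + al"] by blast
  have vd: "v d (2 * pi) < - b"
  proof -
    have dq: "p \<le> d" "d \<le> q" using d by auto
    \<comment> \<open>Turned by \<open>pi\<close>, the solution starts at the bottom of the spike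
      and is below \<open>b\<close> at \<open>- S\<close>, so \<open>not_at_bottom\<close> makes it
      leave on the right.\<close>
    define w where "w t = - v d (t + pi)" for t
    have w: "sol w (\<lambda>t. - dv d (t + pi))"
      using sol_shift[OF v_sol[OF dq]] by (simp add: w_def[abs_def])
    have w0: "w 0 = al" using d by (simp add: w_def)
    have "w (- S) < b"
      using min_principle[OF v_sol[OF dq], of 0 pi "pi - S"] v_0[OF dq] d(3) al_neg b_pos S_pos S_less_pi
      by (simp add: w_def)
    hence "\<not> w S < b" using not_at_bottom[OF w] w0 by blast
    hence "\<not> w pi \<le> b" using max_principle[OF w, of 0 pi S] w0 al_less_b S_pos S_less_pi by auto
    thus ?thesis by (simp add: w_def)
  qed
  define H where "H = {a \<in> {p..d}. \<forall>t\<in>{0..2 * pi}. v a t \<le> - r}"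
  have "H = {p..d} \<inter> (\<Inter>t\<in>{0..2 * pi}. {a \<in> {p..d}. v a t \<in> {..- r}})"
    by (auto simp: H_def)
  moreover have "closed {a \<in> {p..d}. v a t \<in> {..- r}}" for t
  proof -
    have "continuous_on {p..d} (\<lambda>a. v a t)"
      by (rule continuous_on_subset[OF v_cont_a]) (use d in auto)
    from continuous_closed_preimage[OF this, of "{..- r}"]
    show ?thesis by (simp add: vimage_def Int_def)
  qed
  ultimately have "closed H" by (simp add: closed_INT closed_Int)
  moreover have "bounded H" by (rule bounded_subset[of "{p..d}"]) (auto simp: H_def)
  ultimately have "compact H" by (simp add: compact_eq_bounded_closed)
  moreover have "p \<in> H"
  proof -
    have "v p t \<le> - r" if "t \<ge> 0" for t
      using v_p_less[of t] v_p that minus_b_less_r by (cases "t = 0") auto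
    thus ?thesis using d by (simp add: H_def)
  qed
  ultimately obtain c where c: "c \<in> H" "\<And>a. a \<in> H \<Longrightarrow> a \<le> c"
    using compact_attains_sup[of H] by blast
  have c': "p \<le> c" "c \<le> d" "\<And>t. t \<in> {0..2 * pi} \<Longrightarrow> v c t \<le> - r" using c by (auto simp: H_def)
  have "v c pi \<le> - r" using c'(3)[of pi] by simp
  hence "v c pi < v d pi" using r_pos al_neg d(3) by linarith
  hence "c \<noteq> d" by blast
  hence cd: "c < d" using c' by simp
  have exceed: "\<exists>t\<in>{0..2 * pi}. v a t > - r" if "c < a" "a \<le> d" for a
    using c(2)[of a] that c' by (force simp: H_def)
  \<comment> \<open>All parameters in \<open>(c, d]\<close> exceed \<open>- r\<close>, so the least
    one in \<open>[c, d]\<close> that reaches \<open>- r\<close> is \<open>c\<close> itself;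
    \<open>touches_at_end\<close> then puts the contact at \<open>2 * pi\<close>.\<close>
  have vc: "v c (2 * pi) = - r"
  proof -
    have "\<exists>t\<in>{0..2 * pi}. v d t \<ge> - r" using exceed[OF cd order_refl] by (meson less_imp_le)
    from first_time_parameter[OF c'(1,2) d(2) this]
    obtain a s where a: "c \<le> a" "a \<le> d" "s \<in> {0..2 * pi}" "v a s \<ge> - r"
      and less: "\<And>a' t. c \<le> a' \<Longrightarrow> a' < a \<Longrightarrow> t \<in> {0..2 * pi} \<Longrightarrow> v a' t < - r"
      by blast
    have "a = c"
    proof (rule ccontr)
      assume "a \<noteq> c"
      then obtain a' where a': "c < a'" "a' < a" using dense[of c a] a(1) by auto
      then obtain t where "t \<in> {0..2 * pi}" "v a' t > - r" using exceed[of a'] a(2) by force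
      thus False using less[of a' t] a' by force
    qed
    hence s: "v c s = - r" using a(3,4) c'(3)[of s] by simp
    have c_q: "c \<le> q" using c' d by simp
    have "s = 2 * pi"
    proof (rule touches_at_end[OF v_sol[OF c'(1) c_q]])
      show "v c 0 < - r" using v_0[OF c'(1) c_q] al_less by linarith
    qed (use s a(3) c'(3) in simp_all)
    thus ?thesis using s by simp
  qed
  \<comment> \<open>Slightly beyond \<open>c\<close> the value at \<open>2 * pi\<close> is still
    close to \<open>- r\<close>, hence above \<open>al\<close>.\<close>
  obtain a1 where a1: "c < a1" "a1 < d" "v a1 (2 * pi) > al"
    by (rule continuous_gt_right[OF v_cont_a[of "2 * pi"] c'(1) cd d(2)]) (use vc al_less in auto)
  have "continuous_on {a1..d} (\<lambda>a. - v a (2 * pi))"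
    by (intro continuous_on_minus continuous_on_subset[OF v_cont_a]) (use a1 c' d in auto)
  then obtain l h where lh: "a1 \<le> l" "l \<le> h" "h \<le> d" "- v l (2 * pi) = - al" "- v h (2 * pi) = b"
    "\<And>a. l \<le> a \<Longrightarrow> a \<le> h \<Longrightarrow> - al \<le> - v a (2 * pi) \<and> - v a (2 * pi) \<le> b"
    by (rule crossing_subinterval[where lo = "- al" and hi = b]) (use a1 vd al_gt in auto)
  have "h \<noteq> d" using lh(5) vd by auto
  hence hd: "h < d" using lh by simp
  show ?thesis
  proof (rule that[of l h])
    show "p \<le> l" "l \<le> h" "h \<le> q" "v l (2 * pi) = al" "v h (2 * pi) = - b"
      using lh a1 c' d hd by auto
    fix a assume a: "l \<le> a" "a \<le> h"
    show "- b \<le> v a (2 * pi) \<and> v a (2 * pi) \<le> al" using lh(6)[OF a] by simp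
    show "v a pi < - al" using below[of a] a lh(1) a1(1) c'(1) hd by simp
    obtain t where t: "t \<in> {0..2 * pi}" "v a t > - r" using exceed[of a] a lh(1) a1(1) hd by force
    \<comment> \<open>At both end times the value is at most \<open>al < - r\<close>, so the excess
      occurs strictly inside.\<close>
    have "v a 0 < - r" using v_0[of a] al_less a(1,2) lh(1,3) a1(1) c'(1) d(2) by linarith
    hence "t \<noteq> 0" using t(2) by force
    moreover have "t \<noteq> 2 * pi" using t lh(6)[OF a] al_less by auto
    ultimately show "\<exists>t\<in>{0<..<2 * pi}. v a t > - r" using t by (intro bexI[of _ t]) auto
  qed
qed

end

section \<open>Symbolic coding\<close>

context spike_solution
begin

definition V :: "nat \<Rightarrow> real \<Rightarrow> real \<Rightarrow> real" where
  "V n a t = (- 1) ^ n * U a (t + real n * pi)"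

definition dV :: "nat \<Rightarrow> real \<Rightarrow> real \<Rightarrow> real" where
  "dV n a t = (- 1) ^ n * dU a (t + real n * pi)"

lemma V_Suc: "V (Suc n) a t = - V n a (t + pi)" and dV_Suc: "dV (Suc n) a t = - dV n a (t + pi)"
  by (simp_all add: V_def dV_def algebra_simps)

lemma V_Suc_Suc: "V (Suc (Suc n)) a t = V n a (t + 2 * pi)"
  by (simp add: V_Suc algebra_simps)

lemma V_sol: "sol (V n a) (dV n a)"
proof (induction n)
  case 0
  show ?case using U(1) by (simp add: V_def[abs_def] dV_def[abs_def])
next
  case (Suc n)
  show ?case using sol_shift[OF Suc] by (simp add: V_Suc[abs_def] dV_Suc[abs_def])
qed

lemma V_continuous: "continuous_on A (\<lambda>(a, t). V n a t)"
proof -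
  have "continuous_on A (\<lambda>x. (\<lambda>(a, t). U a t) (fst x, snd x + real n * pi))"
    by (rule continuous_on_compose2[OF U_continuous[of UNIV]]) (auto intro!: continuous_intros)
  thus ?thesis unfolding V_def case_prod_unfold by (intro continuous_intros) auto
qed

lemma V_at_start: "V n a (- (real n * pi)) = (- 1) ^ n * a"
  by (simp add: V_def U)

lemma abs_V_at_start: "- b \<le> a \<Longrightarrow> a \<le> al \<Longrightarrow> \<bar>V n a (- (real n * pi))\<bar> \<le> b"
  using al_less_b by (simp add: V_at_start abs_mult power_abs)

text \<open>With the wrong slope the solution followed backwards leaves \<open>[- b, b]\<close> for
  good, yet at the original time \<open>0\<close> it is inside. For \<open>n = 0\<close> the slope
  vanishes.\<close>

lemma V_boundary_slopes:
  assumes a: "- b \<le> a" "a \<le> al"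
  shows "V n a 0 = - b \<Longrightarrow> dV n a 0 \<le> 0" "V n a 0 = al \<Longrightarrow> dV n a 0 \<ge> 0"
proof -
  have n: "real n * pi > S" if "n > 0"
  proof -
    have "1 * pi \<le> real n * pi" using that pi_ge_zero by (intro mult_right_mono) auto
    thus ?thesis using S_less_pi by linarith
  qed
  have bd: "- b \<le> V n a (- (real n * pi))" "V n a (- (real n * pi)) \<le> b"
    using abs_V_at_start[OF a, of n] by linarith+
  show "dV n a 0 \<le> 0" if "V n a 0 = - b"
  proof (cases "n = 0")
    case False
    show ?thesis
      using escape_down[OF sol_reflect[OF V_sol[of n a]], of 0 "real n * pi"] that bd n False S_pos
      by force
  qed (simp add: dV_def U)
  show "dV n a 0 \<ge> 0" if "V n a 0 = al"
  proof (cases "n = 0")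
    case False
    show ?thesis
      using leaves_up[OF sol_reflect[OF V_sol[of n a]], of "real n * pi"] that bd n False by force
  qed (simp add: dV_def U)
qed

definition sweeps :: "nat \<Rightarrow> real \<Rightarrow> real \<Rightarrow> bool" where
  "sweeps n l h \<longleftrightarrow> l \<le> h \<and> - b \<le> l \<and> h \<le> al \<and>
    (\<forall>a\<in>{l..h}. - b \<le> V n a 0 \<and> V n a 0 \<le> al) \<and>
    (V n l 0 = - b \<and> V n h 0 = al \<or> V n l 0 = al \<and> V n h 0 = - b)"

text \<open>A falling sweep becomes a rising family when the parameter \<open>a\<close> is replaced
  by \<open>- a\<close>.\<close>

lemma sweeps_cases:
  assumes "sweeps n l h"
  obtains "rising_family e lam b al S W dW (V n) (dV n) l h"
  | "rising_family e lam b al S W dW (\<lambda>a. V n (- a)) (\<lambda>a. dV n (- a)) (- h) (- l)"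
proof -
  have lh: "l \<le> h" "- b \<le> l" "h \<le> al" "\<And>a. l \<le> a \<Longrightarrow> a \<le> h \<Longrightarrow> - b \<le> V n a 0 \<and> V n a 0 \<le> al"
    using assms by (auto simp: sweeps_def)
  have sl: "- b \<le> l" "l \<le> al" "- b \<le> h" "h \<le> al" using lh by auto
  consider "V n l 0 = - b" "V n h 0 = al" | "V n l 0 = al" "V n h 0 = - b"
    using assms by (auto simp: sweeps_def)
  thus ?thesis
  proof cases
    case 1
    show ?thesis
      by (rule that(1), unfold_locales)
        (use lh 1 V_boundary_slopes[OF sl(1,2)] V_boundary_slopes[OF sl(3,4)] V_sol V_continuous in auto)
  next
    case 2
    have "continuous_on A (\<lambda>x. (\<lambda>(a, t). V n a t) (- fst x, snd x))" for A
      by (rule continuous_on_compose2[OF V_continuous[of UNIV]]) (auto intro!: continuous_intros)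
    hence "continuous_on A (\<lambda>(a, t). V n (- a) t)" for A by (simp add: case_prod_unfold)
    thus ?thesis
      by (intro that(2), unfold_locales)
        (use lh 2 V_boundary_slopes[OF sl(1,2)] V_boundary_slopes[OF sl(3,4)] V_sol in auto)
  qed
qed

lemma sweeps_cross:
  assumes "sweeps n l h"
  shows "\<exists>l' h'. l \<le> l' \<and> h' \<le> h \<and> sweeps (Suc n) l' h'"
proof -
  have lh: "- b \<le> l" "h \<le> al" using assms by (auto simp: sweeps_def)
  from assms show ?thesis
  proof (cases rule: sweeps_cases)
    case 1
    then interpret rising_family e lam b al S W dW "V n" "dV n" l h .
    obtain l' h' where m: "l \<le> l'" "l' \<le> h'" "h' \<le> h" "V n l' pi = - al" "V n h' pi = b"
      "\<And>a. l' \<le> a \<Longrightarrow> a \<le> h' \<Longrightarrow> - al \<le> V n a pi \<and> V n a pi \<le> b"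
      using move_cross by blast
    have "- b \<le> V (Suc n) a 0 \<and> V (Suc n) a 0 \<le> al" if "l' \<le> a" "a \<le> h'" for a
      using m(6)[OF that] by (auto simp: V_Suc)
    moreover have "V (Suc n) l' 0 = al" "V (Suc n) h' 0 = - b" using m(4,5) by (simp_all add: V_Suc)
    ultimately show ?thesis using lh m(1-3)
      by - (rule exI[of _ l'], rule exI[of _ h'], simp add: sweeps_def)
  next
    case 2
    then interpret rising_family e lam b al S W dW "\<lambda>a. V n (- a)" "\<lambda>a. dV n (- a)" "- h" "- l" .
    obtain l' h' where m: "- h \<le> l'" "l' \<le> h'" "h' \<le> - l" "V n (- l') pi = - al" "V n (- h') pi = b"
      "\<And>a. l' \<le> a \<Longrightarrow> a \<le> h' \<Longrightarrow> - al \<le> V n (- a) pi \<and> V n (- a) pi \<le> b"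
      using move_cross by blast
    have "- b \<le> V (Suc n) a 0 \<and> V (Suc n) a 0 \<le> al" if "- h' \<le> a" "a \<le> - l'" for a
      using m(6)[of "- a"] that by (auto simp: V_Suc)
    moreover have "V (Suc n) (- l') 0 = al" "V (Suc n) (- h') 0 = - b" using m(4,5) by (simp_all add: V_Suc)
    ultimately show ?thesis using lh m(1-3)
      by - (rule exI[of _ "- h'"], rule exI[of _ "- l'"], simp add: sweeps_def)
  qed
qed

lemma sweeps_stay:
  assumes "sweeps n l h"
  shows "\<exists>l' h'. l \<le> l' \<and> h' \<le> h \<and> sweeps (Suc (Suc n)) l' h' \<and>
    (\<forall>a\<in>{l'..h'}. \<forall>t\<in>{0..2 * pi}. V n a t < - r)"
proof -
  have lh: "- b \<le> l" "h \<le> al" using assms by (auto simp: sweeps_def)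
  from assms show ?thesis
  proof (cases rule: sweeps_cases)
    case 1
    then interpret rising_family e lam b al S W dW "V n" "dV n" l h .
    obtain l' h' where "l \<le> l'" "l' \<le> h'" "h' \<le> h" "V n l' (2 * pi) = - b" "V n h' (2 * pi) = al"
      "\<And>a. l' \<le> a \<Longrightarrow> a \<le> h' \<Longrightarrow> - b \<le> V n a (2 * pi) \<and> V n a (2 * pi) \<le> al"
      "\<And>a t. l' \<le> a \<Longrightarrow> a \<le> h' \<Longrightarrow> t \<in> {0..2 * pi} \<Longrightarrow> V n a t < - r"
      using move_stay by blast
    thus ?thesis using lh
      by - (rule exI[of _ l'], rule exI[of _ h'], simp add: sweeps_def V_Suc_Suc)
  next
    case 2
    then interpret rising_family e lam b al S W dW "\<lambda>a. V n (- a)" "\<lambda>a. dV n (- a)" "- h" "- l" .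
    obtain l' h' where m: "- h \<le> l'" "l' \<le> h'" "h' \<le> - l"
      "V n (- l') (2 * pi) = - b" "V n (- h') (2 * pi) = al"
      "\<And>a. l' \<le> a \<Longrightarrow> a \<le> h' \<Longrightarrow> - b \<le> V n (- a) (2 * pi) \<and> V n (- a) (2 * pi) \<le> al"
      "\<And>a t. l' \<le> a \<Longrightarrow> a \<le> h' \<Longrightarrow> t \<in> {0..2 * pi} \<Longrightarrow> V n (- a) t < - r"
      using move_stay by blast
    have "- b \<le> V n a (2 * pi) \<and> V n a (2 * pi) \<le> al \<and> (\<forall>t\<in>{0..2 * pi}. V n a t < - r)"
      if "- h' \<le> a" "a \<le> - l'" for a
      using m(6)[of "- a"] m(7)[of "- a"] that by simp
    thus ?thesis using lh m(1-5)
      by - (rule exI[of _ "- h'"], rule exI[of _ "- l'"], simp add: sweeps_def V_Suc_Suc)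
  qed
qed

lemma sweeps_spike:
  assumes "sweeps n l h"
  shows "\<exists>l' h'. l \<le> l' \<and> h' \<le> h \<and> sweeps (Suc (Suc n)) l' h' \<and>
    (\<forall>a\<in>{l'..h'}. V n a pi < - al \<and> (\<exists>t\<in>{0<..<2 * pi}. V n a t > - r))"
proof -
  have lh: "- b \<le> l" "h \<le> al" using assms by (auto simp: sweeps_def)
  from assms show ?thesis
  proof (cases rule: sweeps_cases)
    case 1
    then interpret rising_family e lam b al S W dW "V n" "dV n" l h .
    obtain l' h' where "l \<le> l'" "l' \<le> h'" "h' \<le> h" "V n l' (2 * pi) = al" "V n h' (2 * pi) = - b"
      "\<And>a. l' \<le> a \<Longrightarrow> a \<le> h' \<Longrightarrow> - b \<le> V n a (2 * pi) \<and> V n a (2 * pi) \<le> al"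
      "\<And>a. l' \<le> a \<Longrightarrow> a \<le> h' \<Longrightarrow> V n a pi < - al"
      "\<And>a. l' \<le> a \<Longrightarrow> a \<le> h' \<Longrightarrow> \<exists>t\<in>{0<..<2 * pi}. V n a t > - r"
      using move_spike by blast
    thus ?thesis using lh
      by - (rule exI[of _ l'], rule exI[of _ h'], simp add: sweeps_def V_Suc_Suc)
  next
    case 2
    then interpret rising_family e lam b al S W dW "\<lambda>a. V n (- a)" "\<lambda>a. dV n (- a)" "- h" "- l" .
    obtain l' h' where m: "- h \<le> l'" "l' \<le> h'" "h' \<le> - l"
      "V n (- l') (2 * pi) = al" "V n (- h') (2 * pi) = - b"
      "\<And>a. l' \<le> a \<Longrightarrow> a \<le> h' \<Longrightarrow> - b \<le> V n (- a) (2 * pi) \<and> V n (- a) (2 * pi) \<le> al"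
      "\<And>a. l' \<le> a \<Longrightarrow> a \<le> h' \<Longrightarrow> V n (- a) pi < - al"
      "\<And>a. l' \<le> a \<Longrightarrow> a \<le> h' \<Longrightarrow> \<exists>t\<in>{0<..<2 * pi}. V n (- a) t > - r"
      using move_spike by blast
    have "- b \<le> V n a (2 * pi) \<and> V n a (2 * pi) \<le> al \<and> V n a pi < - al \<and> (\<exists>t\<in>{0<..<2 * pi}. V n a t > - r)"
      if "- h' \<le> a" "a \<le> - l'" for a
      using m(6-8)[of "- a"] that by simp
    thus ?thesis using lh m(1-5)
      by - (rule exI[of _ "- h'"], rule exI[of _ "- l'"], simp add: sweeps_def V_Suc_Suc)
  qed
qed

section \<open>From moves to symbols\<close>

lemma sweeps_0: "sweeps 0 (- b) al"
  using al_gt by (auto simp: sweeps_def V_def U)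

text \<open>\<open>code c k a\<close>: the solution starting at \<open>a\<close> realizes the symbol \<open>c\<close> at \<open>\<omega>\<^sub>k\<^sub>+\<^sub>1\<close>.
  Since \<open>V n\<close> is turned so that \<open>w\<^sub>n\<close> becomes \<open>w\<^sub>0\<close>, the sign of \<open>V n a 0 - al\<close> decides
  whether \<open>w\<^sub>n\<close> is met twice or not at all.\<close>

definition code :: "nat \<Rightarrow> nat \<Rightarrow> real \<Rightarrow> bool" where
  "code c k a \<longleftrightarrow>
    (c \<in> {1, 2} \<longrightarrow> V (2 * k + 1) a 0 > al \<and> V (2 * k + 2) a 0 \<le> al) \<and>
    (c = 1 \<longrightarrow> (\<forall>t\<in>{0..2 * pi}. V (2 * k) a t < - r)) \<and>
    (c = 2 \<longrightarrow> (\<exists>t\<in>{0<..<2 * pi}. V (2 * k) a t > - r)) \<and>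
    (c = 3 \<longrightarrow> V (2 * k + 1) a 0 \<le> al \<and> V (2 * k + 2) a 0 \<le> al) \<and>
    (c \<in> {4, 5} \<longrightarrow> V (2 * k + 1) a 0 \<le> al \<and> V (2 * k + 2) a 0 > al \<and> V (2 * k + 3) a 0 \<le> al) \<and>
    (c = 4 \<longrightarrow> (\<exists>t\<in>{0<..<2 * pi}. V (2 * k + 1) a t > - r)) \<and>
    (c = 5 \<longrightarrow> (\<forall>t\<in>{0..2 * pi}. V (2 * k + 1) a t < - r))"

text \<open>The index at which the sweep resumes after symbol number \<open>k\<close>. Symbols 4 and
  5 describe a window ending at the odd multiple \<open>(2 * k + 1) * pi\<close>, one step later
  than the others.\<close>

definition code_position :: "nat \<Rightarrow> nat \<Rightarrow> nat" where
  "code_position c k = (if c \<in> {4, 5} then 2 * k + 1 else 2 * k)"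

lemma sweeps_le_al: "sweeps n l h \<Longrightarrow> a \<in> {l..h} \<Longrightarrow> V n a 0 \<le> al"
  by (simp add: sweeps_def)

text \<open>Symbol 1 is a stay, 2 a spike, 3 two crossings, 4 a crossing and a spike, 5 a crossing
  and a stay. In a stay the value at the middle is below \<open>- r < - al\<close>, so the
  intermediate spike is met.\<close>

lemma code_from_even:
  assumes sweeps: "sweeps (2 * k) l h" and c: "c \<in> {1, 2, 3, 4, 5}"
  shows "\<exists>l' h'. l \<le> l' \<and> h' \<le> h \<and> sweeps (code_position c (Suc k)) l' h' \<and> (\<forall>a\<in>{l'..h'}. code c k a)"
proof -
  consider "c = 1" | "c = 2" | "c = 3" | "c = 4" | "c = 5" using c by auto
  thus ?thesis
  proof cases
    case 1
    obtain l' h' where m: "l \<le> l'" "h' \<le> h" "sweeps (Suc (Suc (2 * k))) l' h'"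
      "\<forall>a\<in>{l'..h'}. \<forall>t\<in>{0..2 * pi}. V (2 * k) a t < - r"
      using sweeps_stay[OF sweeps] by blast
    have "V (Suc (2 * k)) a 0 > al" if "a \<in> {l'..h'}" for a
    proof -
      have "V (2 * k) a pi < - r" using m(4) that by simp
      hence "V (2 * k) a pi < - al" using al_neg r_pos by linarith
      thus ?thesis by (simp add: V_Suc)
    qed
    thus ?thesis using m sweeps_le_al[OF m(3)] 1
      by - (rule exI[of _ l'], rule exI[of _ h'], auto simp: code_def code_position_def)
  next
    case 2
    obtain l' h' where m: "l \<le> l'" "h' \<le> h" "sweeps (Suc (Suc (2 * k))) l' h'"
      "\<forall>a\<in>{l'..h'}. V (2 * k) a pi < - al \<and> (\<exists>t\<in>{0<..<2 * pi}. V (2 * k) a t > - r)"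
      using sweeps_spike[OF sweeps] by blast
    have "V (Suc (2 * k)) a 0 > al" if "a \<in> {l'..h'}" for a
      using bspec[OF m(4) that] by (simp add: V_Suc)
    thus ?thesis using m sweeps_le_al[OF m(3)] 2
      by - (rule exI[of _ l'], rule exI[of _ h'], auto simp: code_def code_position_def)
  next
    case 3
    obtain l1 h1 where m: "l \<le> l1" "h1 \<le> h" "sweeps (Suc (2 * k)) l1 h1" using sweeps_cross[OF sweeps] by blast
    obtain l' h' where m': "l1 \<le> l'" "h' \<le> h1" "sweeps (Suc (Suc (2 * k))) l' h'" using sweeps_cross[OF m(3)] by blast
    show ?thesis using m m' sweeps_le_al[OF m(3)] sweeps_le_al[OF m'(3)] 3
      by - (rule exI[of _ l'], rule exI[of _ h'], auto simp: code_def code_position_def)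
  next
    case 4
    obtain l1 h1 where m: "l \<le> l1" "h1 \<le> h" "sweeps (Suc (2 * k)) l1 h1" using sweeps_cross[OF sweeps] by blast
    obtain l' h' where m': "l1 \<le> l'" "h' \<le> h1" "sweeps (Suc (Suc (Suc (2 * k)))) l' h'"
      "\<forall>a\<in>{l'..h'}. V (Suc (2 * k)) a pi < - al \<and> (\<exists>t\<in>{0<..<2 * pi}. V (Suc (2 * k)) a t > - r)"
      using sweeps_spike[OF m(3)] by blast
    have "V (Suc (Suc (2 * k))) a 0 > al" if "a \<in> {l'..h'}" for a
      using bspec[OF m'(4) that] by (simp add: V_Suc[of "Suc (2 * k)"])
    thus ?thesis using m m' sweeps_le_al[OF m(3)] sweeps_le_al[OF m'(3)] 4
      by - (rule exI[of _ l'], rule exI[of _ h'], auto simp: code_def code_position_def eval_nat_numeral)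
  next
    case 5
    obtain l1 h1 where m: "l \<le> l1" "h1 \<le> h" "sweeps (Suc (2 * k)) l1 h1" using sweeps_cross[OF sweeps] by blast
    obtain l' h' where m': "l1 \<le> l'" "h' \<le> h1" "sweeps (Suc (Suc (Suc (2 * k)))) l' h'"
      "\<forall>a\<in>{l'..h'}. \<forall>t\<in>{0..2 * pi}. V (Suc (2 * k)) a t < - r"
      using sweeps_stay[OF m(3)] by blast
    have "V (Suc (Suc (2 * k))) a 0 > al" if "a \<in> {l'..h'}" for a
    proof -
      have "V (Suc (2 * k)) a pi < - r" using m'(4) that by simp
      hence "V (Suc (2 * k)) a pi < - al" using al_neg r_pos by linarith
      thus ?thesis by (simp add: V_Suc[of "Suc (2 * k)"])
    qed
    thus ?thesis using m m' sweeps_le_al[OF m(3)] sweeps_le_al[OF m'(3)] 5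
      by - (rule exI[of _ l'], rule exI[of _ h'], auto simp: code_def code_position_def eval_nat_numeral)
  qed
qed

text \<open>Entering at an odd index means that the spike of index \<open>2 * k + 1\<close> is not
  met, as the symbols 3, 4 and 5 require; their first crossing has already been made.\<close>

lemma code_from_odd:
  assumes sweeps: "sweeps (2 * k + 1) l h" and c: "c \<in> {3, 4, 5}"
  shows "\<exists>l' h'. l \<le> l' \<and> h' \<le> h \<and> sweeps (code_position c (Suc k)) l' h' \<and> (\<forall>a\<in>{l'..h'}. code c k a)"
proof -
  have m: "sweeps (Suc (2 * k)) l h" using sweeps by simp
  consider "c = 3" | "c = 4" | "c = 5" using c by auto
  thus ?thesis
  proof cases
    case 1
    obtain l' h' where m': "l \<le> l'" "h' \<le> h" "sweeps (Suc (Suc (2 * k))) l' h'" using sweeps_cross[OF m] by blast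
    show ?thesis using m' sweeps_le_al[OF m] sweeps_le_al[OF m'(3)] 1
      by - (rule exI[of _ l'], rule exI[of _ h'], auto simp: code_def code_position_def)
  next
    case 2
    obtain l' h' where m': "l \<le> l'" "h' \<le> h" "sweeps (Suc (Suc (Suc (2 * k)))) l' h'"
      "\<forall>a\<in>{l'..h'}. V (Suc (2 * k)) a pi < - al \<and> (\<exists>t\<in>{0<..<2 * pi}. V (Suc (2 * k)) a t > - r)"
      using sweeps_spike[OF m] by blast
    have "V (Suc (Suc (2 * k))) a 0 > al" if "a \<in> {l'..h'}" for a
      using bspec[OF m'(4) that] by (simp add: V_Suc[of "Suc (2 * k)"])
    thus ?thesis using m' sweeps_le_al[OF m] sweeps_le_al[OF m'(3)] 2
      by - (rule exI[of _ l'], rule exI[of _ h'], auto simp: code_def code_position_def eval_nat_numeral)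
  next
    case 3
    obtain l' h' where m': "l \<le> l'" "h' \<le> h" "sweeps (Suc (Suc (Suc (2 * k)))) l' h'"
      "\<forall>a\<in>{l'..h'}. \<forall>t\<in>{0..2 * pi}. V (Suc (2 * k)) a t < - r"
      using sweeps_stay[OF m] by blast
    have "V (Suc (Suc (2 * k))) a 0 > al" if "a \<in> {l'..h'}" for a
    proof -
      have "V (Suc (2 * k)) a pi < - r" using m'(4) that by simp
      hence "V (Suc (2 * k)) a pi < - al" using al_neg r_pos by linarith
      thus ?thesis by (simp add: V_Suc[of "Suc (2 * k)"])
    qed
    thus ?thesis using m' sweeps_le_al[OF m] sweeps_le_al[OF m'(3)] 3
      by - (rule exI[of _ l'], rule exI[of _ h'], auto simp: code_def code_position_def eval_nat_numeral)
  qed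
qed

text \<open>Dependent choice yields nested parameter intervals, and a common point realizes all
  symbols. The last conclusion records that the solution is inside \<open>[- b, b]\<close> at
  arbitrarily late times.\<close>

lemma coded_solution:
  fixes \<omega> :: "nat \<Rightarrow> nat"
  assumes w: "\<forall>k\<ge>1. \<omega> k \<in> {1, 2, 3, 4, 5}"
    and down: "\<forall>k\<ge>1. \<omega> k \<in> {4, 5} \<longrightarrow> \<omega> (k + 1) \<notin> {1, 2}"
  obtains a where "- b \<le> a" "a \<le> al" "\<And>k. code (\<omega> (Suc k)) k a"
    "\<And>k. \<exists>n\<ge>k. - b \<le> V n a 0 \<and> V n a 0 \<le> al"
proof -
  \<comment> \<open>The index reached after \<open>k\<close> symbols; before any symbol it is
    \<open>0\<close>.\<close>
  define m where "m k = (if k = 0 then 0 else code_position (\<omega> k) k)" for k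
  define P where "P k x \<longleftrightarrow> sweeps (m k) (fst x) (snd x)" for k and x :: "real \<times> real"
  define Q where "Q k x y \<longleftrightarrow> fst x \<le> fst y \<and> snd y \<le> snd x \<and> (\<forall>a\<in>{fst y..snd y}. code (\<omega> (Suc k)) k a)"
    for k and x y :: "real \<times> real"
  have step: "\<exists>y. P (Suc k) y \<and> Q k x y" if "P k x" for k x
  proof -
    have S: "sweeps (m k) (fst x) (snd x)" using that by (simp add: P_def)
    have mS: "m (Suc k) = code_position (\<omega> (Suc k)) (Suc k)" by (simp add: m_def)
    have "\<exists>l' h'. fst x \<le> l' \<and> h' \<le> snd x \<and> sweeps (code_position (\<omega> (Suc k)) (Suc k)) l' h' \<and>
        (\<forall>a\<in>{l'..h'}. code (\<omega> (Suc k)) k a)"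
    \<comment> \<open>The index is odd exactly after a 4 or 5, where the assumption leaves 3, 4 and
      5 for the next symbol.\<close>
    proof (cases "k \<ge> 1 \<and> \<omega> k \<in> {4, 5}")
      case True
      hence "m k = 2 * k + 1" by (auto simp: m_def code_position_def)
      moreover have "\<omega> (Suc k) \<in> {3, 4, 5}" using True w[rule_format, of "Suc k"] down[rule_format, of k] by auto
      ultimately show ?thesis using code_from_odd S by metis
    next
      case False
      hence "m k = 2 * k" by (auto simp: m_def code_position_def)
      moreover have "\<omega> (Suc k) \<in> {1, 2, 3, 4, 5}" using w by simp
      ultimately show ?thesis using code_from_even S by metis
    qed
    then obtain l' h' where "fst x \<le> l'" "h' \<le> snd x" "sweeps (code_position (\<omega> (Suc k)) (Suc k)) l' h'"
      "\<forall>a\<in>{l'..h'}. code (\<omega> (Suc k)) k a" by blast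
    thus ?thesis by (intro exI[of _ "(l', h')"]) (simp add: P_def Q_def mS)
  qed
  have "P 0 (- b, al)" using sweeps_0 by (simp add: P_def m_def)
  then obtain I where I: "\<And>k. P k (I k)" "\<And>k. Q k (I k) (I (Suc k))"
    using dependent_nat_choice[of P Q] step by blast
  have le: "fst (I k) \<le> snd (I k)" for k using I(1)[of k] by (simp add: P_def sweeps_def)
  have inc: "incseq (\<lambda>k. fst (I k))" and dec: "decseq (\<lambda>k. snd (I k))"
    using I(2) by (auto simp: Q_def intro!: incseq_SucI decseq_SucI)
  have cross: "fst (I k) \<le> snd (I j)" for k j
    using incseqD[OF inc, of k "max k j"] decseqD[OF dec, of j "max k j"] le[of "max k j"] by simp
  define a where "a = (SUP k. fst (I k))"
  have bdd: "bdd_above (range (\<lambda>k. fst (I k)))" using cross[of _ 0] by (auto intro!: bdd_aboveI)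
  have a: "a \<in> {fst (I k)..snd (I k)}" for k
    unfolding a_def using cross by (auto intro!: cSUP_upper bdd cSUP_least)
  have Sa: "- b \<le> V (m k) a 0 \<and> V (m k) a 0 \<le> al" for k
    using I(1)[of k] a[of k] by (simp add: P_def sweeps_def)
  have mk: "m k \<ge> k" for k by (simp add: m_def code_position_def)
  show ?thesis
  proof (rule that[of a])
    show "- b \<le> a" "a \<le> al" using I(1)[of 0] a[of 0] by (auto simp: P_def sweeps_def)
    show "code (\<omega> (Suc k)) k a" for k using I(2)[of k] a[of "Suc k"] by (simp add: Q_def)
    show "\<exists>n\<ge>k. - b \<le> V n a 0 \<and> V n a 0 \<le> al" for k using Sa mk by blast
  qed
qed

end

section \<open>Spikes and the original equation\<close>

lemma solves_onD:
  assumes "solves_on e lam u J" "t \<in> J" "e > 0"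
  shows "(u has_real_derivative deriv u t) (at t)"
    "(deriv u has_real_derivative (u t ^ 3 - lam * u t + cos t) / e\<^sup>2) (at t)"
proof -
  have *: "u differentiable (at t)" "deriv u differentiable (at t)"
    "e\<^sup>2 * deriv (deriv u) t = u t ^ 3 - lam * u t + cos t"
    using assms by (auto simp: solves_on_def)
  show "(u has_real_derivative deriv u t) (at t)"
    using * by (simp add: DERIV_deriv_iff_real_differentiable)
  have "deriv (deriv u) t = (u t ^ 3 - lam * u t + cos t) / e\<^sup>2"
    using *(3) \<open>e > 0\<close> by (simp add: field_simps)
  moreover have "(deriv u has_real_derivative deriv (deriv u) t) (at t)"
    using * by (simp add: DERIV_deriv_iff_real_differentiable)
  ultimately show "(deriv u has_real_derivative (u t ^ 3 - lam * u t + cos t) / e\<^sup>2) (at t)"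
    by simp
qed

text \<open>\<open>deriv u\<close> is known to coincide with \<open>du\<close> on \<open>J\<close>
  only; openness of \<open>J\<close> allows the second derivative to be transferred.\<close>

lemma solves_onI:
  assumes "open J" "e > 0"
    and u: "\<And>t. t \<in> J \<Longrightarrow> (u has_real_derivative du t) (at t)"
    and du: "\<And>t. t \<in> J \<Longrightarrow> (du has_real_derivative (u t ^ 3 - lam * u t + cos t) / e\<^sup>2) (at t)"
  shows "solves_on e lam u J"
  unfolding solves_on_def
proof (intro ballI conjI)
  fix t assume t: "t \<in> J"
  have "du s = deriv u s" if "s \<in> J" for s
    using DERIV_imp_deriv[OF u[OF that]] by simp
  with has_field_derivative_transform_within_open[OF du[OF t] \<open>open J\<close> t]
  have D: "(deriv u has_real_derivative (u t ^ 3 - lam * u t + cos t) / e\<^sup>2) (at t)" by blast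
  show "u differentiable (at t)" "deriv u differentiable (at t)"
    using u[OF t] D by (auto simp: real_differentiable_def)
  show "e\<^sup>2 * deriv (deriv u) t = u t ^ 3 - lam * u t + cos t"
    using DERIV_imp_deriv[OF D] \<open>e > 0\<close> by simp
qed

lemma ivp_solution_reflect:
  assumes "ivp_solution e lam a u J" "e > 0"
  shows "ivp_solution e lam a (\<lambda>t. u (- t)) (uminus ` J)"
proof -
  have J: "open J" "is_interval J" "0 \<in> J" "solves_on e lam u J" "u 0 = a" "deriv u 0 = 0"
    using assms(1) by (auto simp: ivp_solution_def)
  have D: "((\<lambda>t. u (- t)) has_real_derivative - deriv u (- t)) (at t)"
    "((\<lambda>t. - deriv u (- t)) has_real_derivative (u (- t) ^ 3 - lam * u (- t) + cos t) / e\<^sup>2) (at t)"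
    if "- t \<in> J" for t
  proof -
    note D = solves_onD[OF J(4) that \<open>e > 0\<close>]
    show "((\<lambda>t. u (- t)) has_real_derivative - deriv u (- t)) (at t)"
      using D(1) by (simp flip: DERIV_mirror)
    have "((\<lambda>t. deriv u (- t)) has_real_derivative - ((u (- t) ^ 3 - lam * u (- t) + cos (- t)) / e\<^sup>2)) (at t)"
      using D(2) by (simp flip: DERIV_mirror)
    from DERIV_minus[OF this]
    show "((\<lambda>t. - deriv u (- t)) has_real_derivative (u (- t) ^ 3 - lam * u (- t) + cos t) / e\<^sup>2) (at t)"
      by simp
  qed
  have "solves_on e lam (\<lambda>t. u (- t)) (uminus ` J)"
  proof (rule solves_onI[OF open_negations[OF J(1)] \<open>e > 0\<close>])
    fix t assume "t \<in> uminus ` J"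
    hence t: "- t \<in> J" by auto
    show "((\<lambda>t. u (- t)) has_real_derivative - deriv u (- t)) (at t)"
      "((\<lambda>t. - deriv u (- t)) has_real_derivative (u (- t) ^ 3 - lam * u (- t) + cos t) / e\<^sup>2) (at t)"
      by (rule D[OF t])+
  qed
  moreover have "deriv (\<lambda>t. u (- t)) 0 = 0" using DERIV_imp_deriv[OF D(1)[of 0]] J by simp
  moreover have "0 \<in> uminus ` J" using J(3) by (rule rev_image_eqI) simp
  ultimately show ?thesis
    using J open_negations[OF J(1)] by (simp add: ivp_solution_def)
qed

lemma interval_subset:
  fixes J :: "real set"
  assumes "is_interval J" "a \<in> J" "c \<in> J"
  shows "{a..c} \<subseteq> J"
  using assms unfolding is_interval_1 by (meson atLeastAtMost_iff subsetI)

section \<open>Uniqueness for the original equation and transfer of the spike\<close>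

context truncated_equation
begin

text \<open>The cubic is only locally Lipschitz, so the constant is taken from bounds of both
  solutions on the compact interval \<open>[0, t]\<close>.\<close>

lemma original_unique_right:
  assumes u: "ivp_solution e lam a u J" and v: "ivp_solution e lam a v J'"
    and t: "t \<in> J" "t \<in> J'" "t \<ge> 0"
  shows "u t = v t"
proof -
  have sub: "{0..t} \<subseteq> J" "{0..t} \<subseteq> J'"
    using u v t interval_subset[of J 0 t] interval_subset[of J' 0 t] by (simp_all add: ivp_solution_def)
  have so: "solves_on e lam u J" "solves_on e lam v J'" "u 0 = v 0" "deriv u 0 = deriv v 0"
    using u v by (auto simp: ivp_solution_def)
  note Du = solves_onD[OF so(1) _ e_pos] and Dv = solves_onD[OF so(2) _ e_pos]
  have "continuous_on {0..t} u" "continuous_on {0..t} v"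
    using sub by (auto intro!: continuous_at_imp_continuous_on DERIV_isCont[OF Du(1)] DERIV_isCont[OF Dv(1)])
  hence "bounded (u ` {0..t})" "bounded (v ` {0..t})"
    by (simp_all add: compact_imp_bounded compact_continuous_image)
  then obtain B C where B: "\<forall>x\<in>u ` {0..t}. \<bar>x\<bar> \<le> B" and C: "\<forall>x\<in>v ` {0..t}. \<bar>x\<bar> \<le> C"
    unfolding bounded_iff by (metis real_norm_def)
  define K where "K = (3 * (max B C)\<^sup>2 + lam) / e\<^sup>2"
  have "(u t - v t)\<^sup>2 + (deriv u t - deriv v t)\<^sup>2
      \<le> ((u 0 - v 0)\<^sup>2 + (deriv u 0 - deriv v 0)\<^sup>2) * exp ((1 + K) * (t - 0))"
  proof (rule DERIV_energy_growth[where ddv = "\<lambda>s. (u s ^ 3 - lam * u s + cos s) / e\<^sup>2 - (v s ^ 3 - lam * v s + cos s) / e\<^sup>2"])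
    fix s assume s: "s \<in> {0..t}"
    have sJ: "s \<in> J" "s \<in> J'" using s sub by auto
    show "((\<lambda>t. u t - v t) has_real_derivative deriv u s - deriv v s) (at s)"
      by (rule DERIV_diff[OF Du(1)[OF sJ(1)] Dv(1)[OF sJ(2)]])
    show "((\<lambda>t. deriv u t - deriv v t) has_real_derivative
        (u s ^ 3 - lam * u s + cos s) / e\<^sup>2 - (v s ^ 3 - lam * v s + cos s) / e\<^sup>2) (at s)"
      by (rule DERIV_diff[OF Du(2)[OF sJ(1)] Dv(2)[OF sJ(2)]])
    have "\<bar>u s\<bar> \<le> max B C" "\<bar>v s\<bar> \<le> max B C" using B C s by force+
    from cubic_lipschitz[OF this, of lam]
    have "\<bar>(u s ^ 3 - lam * u s) - (v s ^ 3 - lam * v s)\<bar> / e\<^sup>2 \<le> (3 * (max B C)\<^sup>2 + lam) * \<bar>u s - v s\<bar> / e\<^sup>2"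
      using lam_pos by (intro divide_right_mono) auto
    moreover have "(u s ^ 3 - lam * u s + cos s) / e\<^sup>2 - (v s ^ 3 - lam * v s + cos s) / e\<^sup>2
        = ((u s ^ 3 - lam * u s) - (v s ^ 3 - lam * v s)) / e\<^sup>2"
      by (simp add: diff_divide_distrib add_divide_distrib)
    ultimately show "\<bar>(u s ^ 3 - lam * u s + cos s) / e\<^sup>2 - (v s ^ 3 - lam * v s + cos s) / e\<^sup>2\<bar>
        \<le> K * \<bar>u s - v s\<bar>"
      using e_pos by (simp add: K_def abs_divide)
  next
    show "K \<ge> 0" using lam_pos by (simp add: K_def)
  qed (use t in auto)
  thus ?thesis using so by (simp add: sum_power2_le_zero_iff)
qed

lemma u_sol_eq:
  assumes u: "ivp_solution e lam a u J" and t: "t \<in> J"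
  shows "t \<in> max_interval e lam a" "u_sol e lam a t = u t"
proof -
  show "t \<in> max_interval e lam a" using assms by (auto simp: max_interval_def)
  have "v t = u t" if v: "ivp_solution e lam a v J'" and t': "t \<in> J'" for v J'
  proof (cases "t \<ge> 0")
    case True
    thus ?thesis using original_unique_right[OF v u t' t] by simp
  next
    case False
    thus ?thesis
      using original_unique_right[OF ivp_solution_reflect[OF v e_pos] ivp_solution_reflect[OF u e_pos], of "- t"] t t'
      by simp
  qed
  thus "u_sol e lam a t = u t" unfolding u_sol_def using u t by (intro the_equality) blast+
qed

lemma cubic_less_left:
  assumes "x < y" "y \<le> - r"
  shows "x ^ 3 - lam * x < y ^ 3 - lam * y"
proof -
  have "r\<^sup>2 < (- x)\<^sup>2" "r\<^sup>2 \<le> (- y)\<^sup>2"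
    using assms lam_pos by (intro power_strict_mono power_mono; simp)+
  moreover have "r * r \<le> (- x) * (- y)" using assms r_pos by (intro mult_mono) linarith+
  ultimately have "x * x + x * y + y * y - lam > 0"
    using lam_eq by (simp add: power2_eq_square)
  hence "(y - x) * (x * x + x * y + y * y - lam) > 0" using assms by simp
  thus ?thesis by (simp add: power3_eq_cube algebra_simps)
qed

text \<open>A root lies in \<open>[- b, - r]\<close>, and the cubic increases strictly to the left
  of \<open>- r\<close>, so this root is the smallest.\<close>

lemma alpha0_ge: "- b \<le> alpha0 lam"
proof -
  define p where "p x = x ^ 3 - lam * x + 1" for x
  have "\<exists>x\<ge>- b. x \<le> - r \<and> p x = 0"
  proof (rule IVT')
    show "p (- b) \<le> 0" using b_cubic by (simp add: p_def)
    have "(- r) ^ 3 - lam * (- r) = 2 * r ^ 3"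
      by (subst (2) lam_eq) (simp add: power3_eq_cube power2_eq_square)
    thus "0 \<le> p (- r)" using r_cubed by (simp add: p_def)
    show "- b \<le> - r" using r_less_b by simp
    show "continuous_on {- b..- r} p" unfolding p_def by (intro continuous_intros)
  qed
  then obtain x where x: "- b \<le> x" "x \<le> - r" "p x = 0" by blast
  have "x \<le> y" if "p y = 0" for y
    using cubic_less_left[of y x] that x by (force simp: p_def)
  hence "alpha0 lam = x"
    unfolding alpha0_def by (intro Least_equality) (use x in \<open>auto simp: p_def\<close>)
  thus ?thesis using x by simp
qed

text \<open>Until it reaches \<open>b\<close> at time \<open>S\<close> the original solution stays
  in \<open>[- b, b]\<close>, where both equations coincide, so it equals \<open>U al\<close> there.
  Beyond \<open>S\<close> only \<open>u_sol > b\<close> is kept, which locates the end of the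
  spike.\<close>

lemma spike_solution_exists:
  assumes al: "alpha0 lam < al" "al < - r"
    and tau: "0 < \<tau>" "\<tau> < pi / 2" "{0..\<tau>} \<subseteq> max_interval e lam al"
      "strict_mono_on {0..\<tau>} (u_sol e lam al)" "u_sol e lam al \<tau> > b"
  obtains S where "spike_solution e lam b al S (U al) (dU al)" "S < \<tau>"
    "\<And>t. \<bar>t\<bar> \<le> \<tau> \<Longrightarrow> t \<in> max_interval e lam al"
    "\<And>t. \<bar>t\<bar> \<le> S \<Longrightarrow> u_sol e lam al t = U al t"
    "\<And>t. S < \<bar>t\<bar> \<Longrightarrow> \<bar>t\<bar> \<le> \<tau> \<Longrightarrow> u_sol e lam al t > b"
proof -
  have al_gt: "- b < al" using al alpha0_ge by simp
  have "\<tau> \<in> max_interval e lam al" using tau by auto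
  then obtain u J where u: "ivp_solution e lam al u J" and tJ: "\<tau> \<in> J"
    by (auto simp: max_interval_def)
  have J: "open J" "is_interval J" "0 \<in> J" "solves_on e lam u J" "u 0 = al" "deriv u 0 = 0"
    using u by (auto simp: ivp_solution_def)
  have sub: "{0..\<tau>} \<subseteq> J" by (rule interval_subset[OF J(2,3) tJ])
  have us: "u_sol e lam al t = u t" if "0 \<le> t" "t \<le> \<tau>" for t
    using u_sol_eq(2)[OF u] sub that by auto
  have us': "u_sol e lam al t = u (- t)" "t \<in> max_interval e lam al" if "- \<tau> \<le> t" "t \<le> 0" for t
  proof -
    have "- t \<in> J" using sub that by auto
    hence "t \<in> uminus ` J" by (rule rev_image_eqI) simp
    thus "u_sol e lam al t = u (- t)" "t \<in> max_interval e lam al"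
      using u_sol_eq[OF ivp_solution_reflect[OF u e_pos]] by auto
  qed
  have mono: "u s < u t" if "0 \<le> s" "s < t" "t \<le> \<tau>" for s t
    using strict_mono_onD[OF tau(4), of s t] us[of s] us[of t] that by simp
  note D = solves_onD[OF J(4) _ e_pos]
  have "continuous_on {0..\<tau>} u"
    using sub by (auto intro!: continuous_at_imp_continuous_on DERIV_isCont[OF D(1)])
  moreover have "u 0 \<le> b" using J(5) al r_less_b r_pos by linarith
  moreover have ub: "b < u \<tau>" using tau us[of \<tau>] by simp
  ultimately have "\<exists>S\<ge>0. S \<le> \<tau> \<and> u S = b" using tau by (intro IVT') auto
  then obtain S where S: "0 \<le> S" "S \<le> \<tau>" "u S = b" by blast
  have S': "0 < S" "S < \<tau>"
    using S ub J(5) al r_less_b r_pos by (cases "S = 0"; cases "S = \<tau>"; force)+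
  have le_S: "al \<le> u t" "u t \<le> b" if "0 \<le> t" "t \<le> S" for t
    using mono[of 0 t] mono[of t S] that S S' J(5) by (cases "t = 0"; cases "t = S"; simp)+
  have eqU: "u t = U al t" if t: "0 \<le> t" "t \<le> S" for t
  proof -
    have "(u t - U al t)\<^sup>2 + (deriv u t - dU al t)\<^sup>2
      \<le> ((u 0 - U al 0)\<^sup>2 + (deriv u 0 - dU al 0)\<^sup>2) * exp ((1 + L) * (t - 0))"
    proof (rule DERIV_energy_growth[where ddv = "\<lambda>s. F (u s) s - F (U al s) s"])
      fix s assume s: "s \<in> {0..t}"
      have sJ: "s \<in> J" using s t S sub by auto
      have "clp (u s) = u s" using le_S[of s] s t al_gt by (intro clp_id) auto
      hence F: "F (u s) s = (u s ^ 3 - lam * u s + cos s) / e\<^sup>2" by (simp add: F_def)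
      show "((\<lambda>s. u s - U al s) has_real_derivative deriv u s - dU al s) (at s)"
        by (rule DERIV_diff[OF D(1)[OF sJ] solD(1)[OF U(1)]])
      show "((\<lambda>s. deriv u s - dU al s) has_real_derivative F (u s) s - F (U al s) s) (at s)"
        unfolding F by (rule DERIV_diff[OF D(2)[OF sJ] solD(2)[OF U(1)]])
    qed (use t L_nonneg F_lipschitz in auto)
    thus ?thesis using J U by (simp add: sum_power2_le_zero_iff)
  qed
  show ?thesis
  proof (rule that[of S])
    show "spike_solution e lam b al S (U al) (dU al)"
    proof unfold_locales
      show "strict_mono_on {0..S} (U al)"
      proof (rule strict_mono_onI)
        fix x y assume "x \<in> {0..S}" "y \<in> {0..S}" "x < y"
        thus "U al x < U al y" using mono[of x y] eqU[of x] eqU[of y] S by simp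
      qed
      show "U al S = b" using eqU[of S] S by simp
      show "S < pi / 2" using S tau by simp
    qed (use U al al_gt S' in auto)
    show "t \<in> max_interval e lam al" if "\<bar>t\<bar> \<le> \<tau>" for t
      using us'(2)[of t] tau(3) that by (cases "t \<ge> 0") auto
    show "u_sol e lam al t = U al t" if "\<bar>t\<bar> \<le> S" for t
      using us[of t] us'(1)[of t] eqU[of t] eqU[of "- t"] even_solution[OF U(1) U(3), of al t] that S
      by (cases "t \<ge> 0") auto
    show "u_sol e lam al t > b" if "S < \<bar>t\<bar>" "\<bar>t\<bar> \<le> \<tau>" for t
      using us[of t] us'(1)[of t] mono[of S t] mono[of S "- t"] that S by (cases "t \<ge> 0") auto
  qed fact
qed

end

section \<open>Spike intervals and meeting sets\<close>

lemma abs_minus_one_powi: "\<bar>(- 1) powi k * x\<bar> = \<bar>x :: real\<bar>"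
  by (simp add: abs_mult power_int_abs)

locale spike_family = spike_solution +
  fixes \<tau> :: real
  assumes S_less_tau: "S < \<tau>" and W_U: "W = U al"
    and in_max: "\<And>t. \<bar>t\<bar> \<le> \<tau> \<Longrightarrow> t \<in> max_interval e lam al"
    and u_sol_W: "\<And>t. \<bar>t\<bar> \<le> S \<Longrightarrow> u_sol e lam al t = W t"
    and u_sol_gt: "\<And>t. S < \<bar>t\<bar> \<Longrightarrow> \<bar>t\<bar> \<le> \<tau> \<Longrightarrow> u_sol e lam al t > b"
begin

text \<open>The component is an interval around the centre and cannot enter the bands between
  distance \<open>S\<close> and distance \<tau>, where the spike exceeds \<open>b\<close> in
  modulus.\<close>

lemma spike_dom_eq: "spike_dom e lam b al k = {of_int k * pi - S..of_int k * pi + S}"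
proof -
  define X where "X = {t. t - of_int k * pi \<in> max_interval e lam al \<and> \<bar>spike e lam al k t\<bar> \<le> b}"
  define c where "c = of_int k * pi"
  have inX: "t \<in> X" if "c - S \<le> t" "t \<le> c + S" for t
  proof -
    have t: "\<bar>t - c\<bar> \<le> S" using that by (simp add: abs_le_iff)
    have "\<bar>W (t - c)\<bar> \<le> b" using W_le_b[OF t] W_ge[of "t - c"] al_gt by (simp add: abs_le_iff)
    thus ?thesis using t in_max[of "t - c"] u_sol_W[OF t] S_less_tau
      by (simp add: X_def spike_def abs_minus_one_powi c_def)
  qed
  have notX: "t \<notin> X" if "S < \<bar>t - c\<bar>" "\<bar>t - c\<bar> \<le> \<tau>" for t
    using u_sol_gt[OF that] b_pos by (simp add: X_def spike_def abs_minus_one_powi c_def)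
  have "connected_component_set X c = {c - S..c + S}"
  proof
    show "{c - S..c + S} \<subseteq> connected_component_set X c"
      by (rule connected_component_maximal) (use inX S_pos in auto)
    have iv: "is_interval (connected_component_set X c)" by (simp add: is_interval_connected_1)
    have c: "c \<in> connected_component_set X c" using inX[of c] S_pos by simp
    show "connected_component_set X c \<subseteq> {c - S..c + S}"
    proof
      fix t assume t: "t \<in> connected_component_set X c"
      have "\<not> t > c + S"
      proof
        assume "t > c + S"
        then obtain s where s: "S < s" "s < min \<tau> (t - c)"
          using dense[of S "min \<tau> (t - c)"] S_less_tau by auto
        hence "c + s \<in> connected_component_set X c"
          by (intro subsetD[OF interval_subset[OF iv c t]]) (use S_pos in auto)
        hence "c + s \<in> X" using connected_component_subset by blast
        thus False using notX[of "c + s"] s S_pos by auto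
      qed
      moreover have "\<not> t < c - S"
      proof
        assume "t < c - S"
        then obtain s where s: "S < s" "s < min \<tau> (c - t)"
          using dense[of S "min \<tau> (c - t)"] S_less_tau by auto
        hence "c - s \<in> connected_component_set X c"
          by (intro subsetD[OF interval_subset[OF iv t c]]) (use S_pos in auto)
        hence "c - s \<in> X" using connected_component_subset by blast
        thus False using notX[of "c - s"] s S_pos by auto
      qed
      ultimately show "t \<in> {c - S..c + S}" by auto
    qed
  qed
  thus ?thesis by (simp add: spike_dom_def X_def c_def)
qed

lemma spike_eq:
  assumes "t \<in> spike_dom e lam b al k"
  shows "spike e lam al k t = (- 1) powi k * W (t - of_int k * pi)"
proof -
  have "\<bar>t - of_int k * pi\<bar> \<le> S" using assms by (auto simp: spike_dom_eq)
  thus ?thesis by (simp add: spike_def u_sol_W)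
qed

lemma spike_dom_unique:
  assumes "t \<in> spike_dom e lam b al j" "t \<in> spike_dom e lam b al k"
  shows "j = k"
proof -
  have "\<bar>of_int j * pi - of_int k * pi\<bar> \<le> 2 * S" using assms by (auto simp: spike_dom_eq)
  moreover have "\<bar>of_int j * pi - of_int k * pi\<bar> = \<bar>of_int (j - k)\<bar> * pi"
    by (simp add: abs_mult flip: left_diff_distrib)
  ultimately have "\<bar>of_int (j - k)\<bar> * pi < 1 * pi" using S_less by linarith
  hence "\<bar>of_int (j - k)\<bar> < (1 :: real)" by (rule mult_right_less_imp_less) simp
  thus ?thesis by linarith
qed

lemma f_plus_eq:
  assumes "even k" "t \<in> spike_dom e lam b al k"
  shows "f_plus e lam b al t = W (t - of_int k * pi)"
proof -
  have "(THE k. even k \<and> t \<in> spike_dom e lam b al k) = k"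
    using assms spike_dom_unique by (intro the_equality) blast+
  thus ?thesis using assms spike_eq[OF assms(2)] by (auto simp: f_plus_def)
qed

lemma f_minus_eq:
  assumes "odd k" "t \<in> spike_dom e lam b al k"
  shows "f_minus e lam b al t = - W (t - of_int k * pi)"
proof -
  have "(THE k. odd k \<and> t \<in> spike_dom e lam b al k) = k"
    using assms spike_dom_unique by (intro the_equality) blast+
  thus ?thesis using assms spike_eq[OF assms(2)] by (auto simp: f_minus_def)
qed

text \<open>The half-length is below \<open>pi\<close>, so only the indices \<open>n\<close>,
  \<open>n + 1\<close> and \<open>n + 2\<close> can reach the window, and parity excludes the middle
  one.\<close>

lemma spike_dom_index:
  assumes t: "real n * pi < t" "t < (real n + 2) * pi" and k: "t \<in> spike_dom e lam b al k" "even (k - int n)"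
  shows "k = int n \<and> t - real n * pi \<le> S \<or> k = int n + 2 \<and> (real n + 2) * pi - t \<le> S"
proof -
  have d: "of_int k * pi - S \<le> t" "t \<le> of_int k * pi + S" using k(1) by (auto simp: spike_dom_eq)
  have "(real n - 1) * pi < of_int k * pi" "of_int k * pi < (real n + 3) * pi"
    using d t S_less_pi by (simp_all add: algebra_simps)
  hence "real n - 1 < of_int k" "of_int k < real n + 3" by simp_all
  hence "int n - 1 < k" "k < int n + 3" by linarith+
  hence "k = int n \<or> k = int n + 1 \<or> k = int n + 2" by linarith
  thus ?thesis using d k(2) by auto
qed

lemma abs_V_less:
  assumes "\<And>t. \<bar>U a t\<bar> < b"
  shows "\<bar>V n a t\<bar> < b"
  using assms[of "t + real n * pi"] by (simp add: V_def abs_mult power_abs)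

text \<open>The spike at the left end of the window is compared along its right half, the one at the
  right end along its left half after two turns.\<close>

lemma below_spikes:
  assumes a: "\<And>t. \<bar>U a t\<bar> < b"
    and n: "V n a 0 \<le> al" "V n a (2 * pi) \<le> al"
  shows "0 < s \<Longrightarrow> s \<le> S \<Longrightarrow> V n a s < W s"
    "2 * pi - S \<le> s \<Longrightarrow> s < 2 * pi \<Longrightarrow> V n a s < W (s - 2 * pi)"
proof -
  have V_less: "V n a s < b" for n s
    using abs_V_less[OF a, of n s] by simp
  show "V n a s < W s" if "0 < s" "s \<le> S"
    by (rule below_W_right[OF V_sol n(1) V_less that])
  have V2: "V (Suc (Suc n)) a t = V n a (t + 2 * pi)" for t by (rule V_Suc_Suc)
  have "V (Suc (Suc n)) a (s - 2 * pi) < W (s - 2 * pi)" if s: "2 * pi - S \<le> s" "s < 2 * pi"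
  proof (rule below_W_left[OF V_sol])
    show "V (Suc (Suc n)) a 0 \<le> al" using n(2) by (simp add: V2)
    show "V (Suc (Suc n)) a (- S) < b"
      by (rule V_less)
  qed (use s in auto)
  thus "V n a s < W (s - 2 * pi)" if "2 * pi - S \<le> s" "s < 2 * pi" using that by (simp add: V2)
qed

lemma spike_meets_eq:
  "spike_meets e lam b al (U a) (int n) = (\<lambda>s. s + real n * pi) ` {s \<in> {- S..S}. V n a s = W s}"
proof -
  have *: "U a t = (- 1) ^ n * V n a (t - real n * pi)" for t
    by (simp add: V_def flip: mult.assoc power_mult_distrib)
  have "spike_meets e lam b al (U a) (int n)
      = {t. - S \<le> t - real n * pi \<and> t - real n * pi \<le> S \<and> V n a (t - real n * pi) = W (t - real n * pi)}"
    using spike_eq[of _ "int n"] unfolding spike_meets_def spike_dom_eq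
    by (auto simp: *)
  also have "\<dots> = (\<lambda>s. s + real n * pi) ` {s \<in> {- S..S}. V n a s = W s}"
  proof (intro equalityI subsetI)
    fix t assume "t \<in> {t. - S \<le> t - real n * pi \<and> t - real n * pi \<le> S \<and> V n a (t - real n * pi) = W (t - real n * pi)}"
    thus "t \<in> (\<lambda>s. s + real n * pi) ` {s \<in> {- S..S}. V n a s = W s}"
      by (intro rev_image_eqI[of "t - real n * pi"]) auto
  qed auto
  finally show ?thesis .
qed

end

section \<open>Reading off the asserted properties\<close>

context spike_family
begin

text \<open>\<open>max_principle\<close> and \<open>min_principle\<close> between time
  \<open>0\<close> and a later return keep the solution inside. The start \<open>- b\<close> is
  excluded because it escapes downwards at once.\<close>

lemma recurrent_bounded:
  assumes a: "- b \<le> a" "a \<le> al" and rec: "\<And>k. \<exists>n\<ge>k. - b \<le> V n a 0 \<and> V n a 0 \<le> al"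
  shows "\<bar>U a t\<bar> < b"
proof -
  have rec': "\<exists>n\<ge>k. \<bar>U a (real n * pi)\<bar> \<le> b" for k
  proof -
    obtain n where n: "n \<ge> k" "- b \<le> V n a 0" "V n a 0 \<le> al" using rec by blast
    hence "\<bar>V n a 0\<bar> \<le> b" using al_less_b by linarith
    moreover have "\<bar>V n a 0\<bar> = \<bar>U a (real n * pi)\<bar>" by (simp add: V_def abs_mult power_abs)
    ultimately show ?thesis using n(1) by auto
  qed
  have pos: "\<bar>U a t\<bar> < b" if "t > 0" for t
  proof -
    obtain k where k: "t / pi < real k" using reals_Archimedean2 by blast
    obtain n where n: "n \<ge> k" "\<bar>U a (real n * pi)\<bar> \<le> b" using rec' by blast
    have "t < real k * pi" using k by (simp add: field_simps)
    also have "\<dots> \<le> real n * pi" using n(1) by (intro mult_right_mono) auto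
    finally have t: "t < real n * pi" .
    have bd: "U a (real n * pi) \<le> b" "- b \<le> U a (real n * pi)" "U a 0 \<le> b" "- b \<le> U a 0"
      using n(2) a al_less_b by (auto simp: U)
    have "U a t < b" by (rule max_principle[OF U(1) bd(3,1) that t])
    moreover have "- b < U a t" by (rule min_principle[OF U(1) bd(4,2) that t])
    ultimately show ?thesis by (simp add: abs_less_iff)
  qed
  have "a \<noteq> - b"
    using escape_down[OF U(1), of a 0 1] pos[of 1] by (auto simp: U)
  hence "\<bar>U a 0\<bar> < b" using a al_less_b by (simp add: U abs_less_iff)
  moreover have "U a t = U a \<bar>t\<bar>"
    using even_solution[OF U(1) U(3), of a t] by (cases "t \<ge> 0") auto
  ultimately show ?thesis using pos[of "\<bar>t\<bar>"] by (cases "t = 0") auto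
qed

lemma meets_twice:
  assumes "\<And>t. \<bar>U a t\<bar> < b" "V n a 0 > al"
  shows "card (spike_meets e lam b al (U a) (int n)) = 2"
proof -
  have "card {s \<in> {- S..S}. V n a s = W s} = 2"
    using abs_V_less[OF assms(1), of n S] abs_V_less[OF assms(1), of n "- S"] assms(2)
    by (intro two_intersections[OF V_sol]) auto
  thus ?thesis unfolding spike_meets_eq by (subst card_image) (auto simp: inj_on_def)
qed

lemma meets_not:
  assumes "\<And>t. \<bar>U a t\<bar> < b" "V n a 0 \<le> al"
  shows "spike_meets e lam b al (U a) (int n) = {}"
proof -
  have "{s \<in> {- S..S}. V n a s = W s} = {}"
    using abs_V_less[OF assms(1), of n S] abs_V_less[OF assms(1), of n "- S"] assms(2)
    by (intro no_intersection[OF V_sol]) auto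
  thus ?thesis unfolding spike_meets_eq by simp
qed

text \<open>In the window \<open>f_plus\<close> or \<open>f_minus\<close> is either a spike centred
  at one end, handled by \<open>below_spikes\<close>, or the constant barrier. Odd \<open>n\<close>
  changes the sign and thereby exchanges \<open>g_minus\<close> and \<open>g_plus\<close>.\<close>

lemma stays_beyond_g:
  assumes a: "\<And>t. \<bar>U a t\<bar> < b" and n: "V n a 0 \<le> al" "V n a (2 * pi) \<le> al"
    and low: "\<forall>s\<in>{0..2 * pi}. V n a s < - r"
    and t: "real n * pi < t" "t < (real n + 2) * pi"
  shows "even n \<Longrightarrow> U a t < g_minus e lam b al t" "odd n \<Longrightarrow> U a t > g_plus e lam b al t"
proof -
  define s where "s = t - real n * pi"
  have s: "0 < s" "s < 2 * pi" using t by (auto simp: s_def algebra_simps)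
  have Vr: "V n a s < - r" using low s by simp
  have below: "V n a s < W (t - of_int k * pi)"
    if k: "t \<in> spike_dom e lam b al k" "even (k - int n)" for k
  proof -
    note B = below_spikes[OF a n]
    from spike_dom_index[OF t k] show ?thesis
    proof
      assume "k = int n \<and> t - real n * pi \<le> S"
      thus ?thesis using B(1)[of s] s by (simp add: s_def)
    next
      assume *: "k = int n + 2 \<and> (real n + 2) * pi - t \<le> S"
      hence "2 * pi - S \<le> s" by (simp add: s_def algebra_simps)
      from B(2)[OF this s(2)] * show ?thesis by (simp add: s_def algebra_simps)
    qed
  qed
  have Vb: "V n a s < b" using abs_V_less[OF a, of n s] by simp
  show "U a t < g_minus e lam b al t" if ev: "even n"
  proof -
    have U: "U a t = V n a s" using ev by (simp add: V_def s_def)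
    have "V n a s < f_plus e lam b al t"
    proof (cases "\<exists>k. even k \<and> t \<in> spike_dom e lam b al k")
      case True
      then obtain k where "even k" "t \<in> spike_dom e lam b al k" by blast
      thus ?thesis using below[of k] ev by (simp add: f_plus_eq)
    next
      case False
      thus ?thesis unfolding f_plus_def using Vb by (subst if_not_P)
    qed
    thus ?thesis using Vr by (simp add: g_minus_def U)
  qed
  show "U a t > g_plus e lam b al t" if od: "odd n"
  proof -
    have U: "U a t = - V n a s" using od by (simp add: V_def s_def)
    have "f_minus e lam b al t < - V n a s"
    proof (cases "\<exists>k. odd k \<and> t \<in> spike_dom e lam b al k")
      case True
      then obtain k where "odd k" "t \<in> spike_dom e lam b al k" by blast
      thus ?thesis using below[of k] od by (simp add: f_minus_eq)
    next
      case False
      thus ?thesis unfolding f_minus_def using Vb by (subst if_not_P) simp_all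
    qed
    thus ?thesis using Vr by (simp add: g_plus_def U)
  qed
qed

text \<open>Since \<open>g_minus\<close> is at most \<open>- r\<close> and \<open>g_plus\<close> at
  least \<open>r\<close>, passing \<open>- r\<close> is enough.\<close>

lemma leaves_g:
  assumes "\<exists>s\<in>{0<..<2 * pi}. V n a s > - r"
  shows "even n \<Longrightarrow> \<exists>t\<in>{real n * pi<..<(real n + 2) * pi}. U a t > g_minus e lam b al t"
    "odd n \<Longrightarrow> \<exists>t\<in>{real n * pi<..<(real n + 2) * pi}. U a t < g_plus e lam b al t"
proof -
  obtain s where s: "0 < s" "s < 2 * pi" "V n a s > - r" using assms by auto
  have t: "s + real n * pi \<in> {real n * pi<..<(real n + 2) * pi}" using s by (simp add: algebra_simps)
  show "\<exists>t\<in>{real n * pi<..<(real n + 2) * pi}. U a t > g_minus e lam b al t" if "even n"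
    using that s by (intro bexI[OF _ t]) (simp add: V_def g_minus_def)
  show "\<exists>t\<in>{real n * pi<..<(real n + 2) * pi}. U a t < g_plus e lam b al t" if "odd n"
    using that s by (intro bexI[OF _ t]) (simp add: V_def g_plus_def)
qed

lemma bounded_solves:
  assumes "\<And>t. \<bar>U a t\<bar> < b"
  shows "solves_on e lam (U a) UNIV"
proof (rule solves_onI[OF open_UNIV e_pos])
  fix t
  have "clp (U a t) = U a t" using assms[of t] by (intro clp_id) auto
  thus "(dU a has_real_derivative (U a t ^ 3 - lam * U a t + cos t) / e\<^sup>2) (at t)"
    using solD(2)[OF U(1), of a t] by (simp add: F_def)
qed (rule solD(1)[OF U(1)])

end

theorem theorem15:
  fixes \<epsilon> lam b \<alpha> :: real and \<omega> :: "nat \<Rightarrow> nat"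
  assumes "\<epsilon> > 0"
    and "lam > 3 / 2 powr (2 / 3)"
    and "b > 0" and "b ^ 3 - lam * b - 1 > 0"
    and "alpha0 lam < \<alpha>" and "\<alpha> < - sqrt (lam / 3)"
    and "\<exists>\<tau>. 0 < \<tau> \<and> \<tau> < pi / 2 \<and> {0..\<tau>} \<subseteq> max_interval \<epsilon> lam \<alpha> \<and>
           strict_mono_on {0..\<tau>} (u_sol \<epsilon> lam \<alpha>) \<and> u_sol \<epsilon> lam \<alpha> \<tau> > b"
    and "\<forall>k\<ge>1. \<omega> k \<in> {1, 2, 3, 4, 5}"
    and "\<forall>k\<ge>1. \<omega> k \<in> {1, 2} \<longrightarrow> \<omega> (k + 1) \<notin> {4, 5}"
    and "\<forall>k\<ge>1. \<omega> k \<in> {4, 5} \<longrightarrow> \<omega> (k + 1) \<notin> {1, 2}"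
  shows "\<exists>u. solves_on \<epsilon> lam u UNIV \<and>
    (\<forall>k\<ge>1.
      (\<omega> k \<in> {1, 2} \<longrightarrow>
         card (spike_meets \<epsilon> lam b \<alpha> u (2 * int k - 1)) = 2 \<and>
         spike_meets \<epsilon> lam b \<alpha> u (2 * int k) = {}) \<and>
      (\<omega> k = 1 \<longrightarrow>
         (\<forall>t\<in>{(2 * real k - 2) * pi<..<2 * real k * pi}. u t < g_minus \<epsilon> lam b \<alpha> t)) \<and>
      (\<omega> k = 2 \<longrightarrow>
         (\<exists>t\<in>{(2 * real k - 2) * pi<..<2 * real k * pi}. u t > g_minus \<epsilon> lam b \<alpha> t)) \<and>
      (\<omega> k = 3 \<longrightarrow>
         spike_meets \<epsilon> lam b \<alpha> u (2 * int k - 1) = {} \<and>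
         spike_meets \<epsilon> lam b \<alpha> u (2 * int k) = {}) \<and>
      (\<omega> k \<in> {4, 5} \<longrightarrow>
         spike_meets \<epsilon> lam b \<alpha> u (2 * int k - 1) = {} \<and>
         card (spike_meets \<epsilon> lam b \<alpha> u (2 * int k)) = 2) \<and>
      (\<omega> k = 4 \<longrightarrow>
         (\<exists>t\<in>{(2 * real k - 1) * pi<..<(2 * real k + 1) * pi}. u t < g_plus \<epsilon> lam b \<alpha> t)) \<and>
      (\<omega> k = 5 \<longrightarrow>
         (\<forall>t\<in>{(2 * real k - 1) * pi<..<(2 * real k + 1) * pi}. u t > g_plus \<epsilon> lam b \<alpha> t)))"
proof -
  interpret truncated_equation \<epsilon> lam b by unfold_locales fact+
  obtain \<tau> where \<tau>: "0 < \<tau>" "\<tau> < pi / 2" "{0..\<tau>} \<subseteq> max_interval \<epsilon> lam \<alpha>"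
    "strict_mono_on {0..\<tau>} (u_sol \<epsilon> lam \<alpha>)" "u_sol \<epsilon> lam \<alpha> \<tau> > b"
    using assms(7) by blast
  obtain S where "spike_family \<epsilon> lam b \<alpha> S (U \<alpha>) (dU \<alpha>) \<tau>"
  proof (rule spike_solution_exists[OF assms(5,6) \<tau>])
    fix S assume "spike_solution \<epsilon> lam b \<alpha> S (U \<alpha>) (dU \<alpha>)" "S < \<tau>"
      "\<And>t. \<bar>t\<bar> \<le> \<tau> \<Longrightarrow> t \<in> max_interval \<epsilon> lam \<alpha>"
      "\<And>t. \<bar>t\<bar> \<le> S \<Longrightarrow> u_sol \<epsilon> lam \<alpha> t = U \<alpha> t"
      "\<And>t. S < \<bar>t\<bar> \<Longrightarrow> \<bar>t\<bar> \<le> \<tau> \<Longrightarrow> u_sol \<epsilon> lam \<alpha> t > b"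
    thus thesis by (intro that[of S]) (simp add: spike_family_def spike_family_axioms_def)
  qed
  then interpret spike_family \<epsilon> lam b \<alpha> S "U \<alpha>" "dU \<alpha>" \<tau> .
  obtain a where a: "- b \<le> a" "a \<le> \<alpha>" and code: "\<And>k. code (\<omega> (Suc k)) k a"
    and rec: "\<And>k. \<exists>n\<ge>k. - b \<le> V n a 0 \<and> V n a 0 \<le> \<alpha>"
    using coded_solution[OF assms(8,10)] by blast
  have bd: "\<bar>U a t\<bar> < b" for t by (rule recurrent_bounded[OF a rec])
  \<comment> \<open>The window of symbol 1 starts at an even index, whose value is governed by the
    previous symbol; that one is 1, 2 or 3, unless the index is \<open>0\<close>.\<close>
  have even_start: "V (2 * j) a 0 \<le> \<alpha>" if "\<omega> (Suc j) \<in> {1, 2}" for j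
  proof (cases j)
    case 0
    thus ?thesis using a by (simp add: V_def U)
  next
    case (Suc i)
    have "\<omega> (Suc i) \<in> {1, 2, 3, 4, 5}" using assms(8) by simp
    moreover have "\<omega> (Suc i) \<notin> {4, 5}" using assms(10) that Suc by auto
    ultimately have "\<omega> (Suc i) \<in> {1, 2, 3}" by blast
    thus ?thesis using code[of i] Suc by (auto simp: code_def)
  qed
  show ?thesis
  proof (intro exI[of _ "U a"] conjI allI impI)
    show "solves_on \<epsilon> lam (U a) UNIV" by (rule bounded_solves[OF bd])
    fix k :: nat assume "k \<ge> 1"
    then obtain j where k: "k = Suc j" by (cases k) auto
    note c = code[of j, unfolded code_def, folded k]
    \<comment> \<open>Symbols are numbered from 1 but \<open>code\<close> from 0, hence the shift
      \<open>k = Suc j\<close>.\<close>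
    have i: "2 * int k - 1 = int (2 * j + 1)" "2 * int k = int (2 * j + 2)" by (simp_all add: k)
    have e: "(2 * real k - 2) * pi = real (2 * j) * pi" "2 * real k * pi = (real (2 * j) + 2) * pi"
      "(2 * real k - 1) * pi = real (2 * j + 1) * pi" "(2 * real k + 1) * pi = (real (2 * j + 1) + 2) * pi"
      by (simp_all add: k algebra_simps)
    {
      assume w: "\<omega> k \<in> {1, 2}"
      show "card (spike_meets \<epsilon> lam b \<alpha> (U a) (2 * int k - 1)) = 2"
        unfolding i(1) by (rule meets_twice[OF bd]) (use c w in blast)
      show "spike_meets \<epsilon> lam b \<alpha> (U a) (2 * int k) = {}"
        unfolding i(2) by (rule meets_not[OF bd]) (use c w in blast)
    next
      assume w: "\<omega> k = 1"
      have "V (2 * j) a (2 * pi) \<le> \<alpha>" using c w V_Suc_Suc[of "2 * j" a 0] by simp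
      thus "\<forall>t\<in>{(2 * real k - 2) * pi<..<2 * real k * pi}. U a t < g_minus \<epsilon> lam b \<alpha> t"
        unfolding e using stays_beyond_g(1)[OF bd even_start[of j]] c w k by auto
    next
      assume w: "\<omega> k = 2"
      show "\<exists>t\<in>{(2 * real k - 2) * pi<..<2 * real k * pi}. U a t > g_minus \<epsilon> lam b \<alpha> t"
        unfolding e by (rule leaves_g(1)) (use c w in auto)
    next
      assume w: "\<omega> k = 3"
      show "spike_meets \<epsilon> lam b \<alpha> (U a) (2 * int k - 1) = {}"
        unfolding i(1) by (rule meets_not[OF bd]) (use c w in blast)
      show "spike_meets \<epsilon> lam b \<alpha> (U a) (2 * int k) = {}"
        unfolding i(2) by (rule meets_not[OF bd]) (use c w in blast)
    next
      assume w: "\<omega> k \<in> {4, 5}"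
      show "spike_meets \<epsilon> lam b \<alpha> (U a) (2 * int k - 1) = {}"
        unfolding i(1) by (rule meets_not[OF bd]) (use c w in blast)
      show "card (spike_meets \<epsilon> lam b \<alpha> (U a) (2 * int k)) = 2"
        unfolding i(2) by (rule meets_twice[OF bd]) (use c w in blast)
    next
      assume w: "\<omega> k = 4"
      show "\<exists>t\<in>{(2 * real k - 1) * pi<..<(2 * real k + 1) * pi}. U a t < g_plus \<epsilon> lam b \<alpha> t"
        unfolding e by (rule leaves_g(2)) (use c w in auto)
    next
      assume w: "\<omega> k = 5"
      have m: "V (2 * j + 1) a 0 \<le> \<alpha>" "V (2 * j + 3) a 0 \<le> \<alpha>"
        "\<forall>t\<in>{0..2 * pi}. V (2 * j + 1) a t < - sqrt (lam / 3)"
        using c w by auto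
      have "V (2 * j + 1) a (2 * pi) \<le> \<alpha>"
        using m(2) V_Suc_Suc[of "2 * j + 1" a 0] by (simp add: eval_nat_numeral)
      thus "\<forall>t\<in>{(2 * real k - 1) * pi<..<(2 * real k + 1) * pi}. U a t > g_plus \<epsilon> lam b \<alpha> t"
        unfolding e using stays_beyond_g(2)[OF bd m(1) _ m(3)] by auto
    }
  qed
qed

end
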